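(* Let $\alpha,\beta\in\mathbb{R}$ and $\lambda_k(0)=k+\frac{\alpha-\beta}{\pi}$, $k\in\mathbb{Z}$. If $\Delta(\lambda)$ is a function of class $J(\lambda_k(0))$ (defined in the context), then there exist $\mu\in\mathbb{R}$ and $v\in L^2(0,\pi,\mathbb{C}^2)$ such that the characteristic function $\Delta(\mu,\lambda)$ of the operator $D(\mu,v)$ coincides with $\Delta(\lambda)$: $\Delta(\mu,\lambda)=\Delta(\lambda)$ for all $\lambda\in\mathbb{C}$.
   Context: For an entire function $f$, $f^*(\lambda)=\overline{f(\overline\lambda)}$. Operator. $L^2(0,\pi,\mathbb{C}^2)$ has inner product $\langle f,g\rangle=\int_0^\pi(f_1\overline{g_1}+f_2\overline{g_2})\,dx$; $\Phi(\alpha)=(\sin\alpha,\cos\alpha)^T$. For $\mu\in\mathbb{R}$, $v=(v_1,v_2)^T\in L^2(0,\pi,\mathbb{C}^2)$, $(D(\mu,v)y)(x)=\begin{pmatrix}0&1\\-1&0\end{pmatrix}y'(x)+\mu\langle y,v\rangle v(x)$ on absolutely continuous $y:[0,\pi]\to\mathbb{C}^2$ with $y'\in L^2$, $\langle y(0),\Phi(\alpha)\rangle_{\mathbb{C}^2}=0$, $\langle y(\pi),\Phi(\beta)\rangle_{\mathbb{C}^2}=0$. The numbers $\lambda_k(0)$ are the eigenvalues of the unperturbed operator ($\mu=0$). Characteristic function. With $v_\pm=v_1\pm iv_2$, $\widetilde v_\pm(\lambda)=\int_0^\pi e^{-i\lambda x}v_\pm(x)dx$, $\Phi_\pm(\lambda)=\int_0^\pi\int_0^xe^{-i\lambda(x-t)}\overline{v_\pm(t)}\,dt\,v_\pm(x)\,dx$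 and $R(\lambda)=\Phi_+(\lambda)+\Phi_-^*(-\lambda)+e^{2i\alpha}\widetilde v_+(\lambda)\widetilde v_-^*(-\lambda)$ (where $g^*(-\lambda)$ means $g^*$ evaluated at $-\lambda$), the characteristic function of $D(\mu,v)$ is $$\Delta(\mu,\lambda)=\sin(\lambda\pi-\alpha+\beta)-\frac\mu4\left\{e^{i(\lambda\pi+\beta-\alpha)}R(\lambda)+e^{-i(\lambda\pi+\beta-\alpha)}R^*(\lambda)\right\};$$ its zeros form the spectrum of $D(\mu,v)$. Class $J(\lambda_k(0))$. A function $\Delta(\lambda)$ belongs to $J(\lambda_k(0))$ if: (i) $\Delta$ is an entire function of exponential type $\sigma\le\pi$, bounded on the real axis, $\Delta(0)\ne0$, and $\Delta^*=\Delta$; (ii) the zeros $\{a_k\}_{k\in\mathbb{Z}}$ of $\Delta$ are real and simple, except for a finite number of them which have multiplicity $2$ and coincide with some of the $\lambda_s(0)$; (iii) $\{\lambda_k(0)\}$ and $\{a_k\}$ partially interlace: there is a partition $\{\lambda_k(0)\}=A_0\cup A_1$, $A_0\cap A_1=\emptyset$, and a set $B_1\subset\mathbb{R}$ such that $A_1$ and $B_1$ are interlaced (disjoint, and between any two consecutive points of either set there is exactly one point of the other), the zeros of $\Delta$ counted with multiplicity are $A_0\uplus B_1$ (union with multiplicities added), and $A_0\cap B_1$ is finite; (iv) the function $F(\lambda)=\dfrac{\Delta(\lambda)}{\sin(\lambda\pi-\alpha+\beta)}$ satisfies $\lim_{y\to\infty}F(iy)=1$; (v) the limit $\lim_{y\to\infty}y|F(iy)-1|$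 exists and is finite. *)

theory Defs
  imports "HOL-Complex_Analysis.Complex_Analysis"
begin

definition conj_fun :: "(complex \<Rightarrow> complex) \<Rightarrow> complex \<Rightarrow> complex" where
  "conj_fun f z = cnj (f (cnj z))"


(* L^2(0,pi;C^2), with elements represented by Borel functions on the real line whose
   values off {0..pi} are irrelevant; every a.e.-class has such a representative.
   On complex^2, (norm w)^2 = |w_1|^2 + |w_2|^2. *)
definition L2_0_pi :: "(real \<Rightarrow> complex ^ 2) set" where
  "L2_0_pi = {v. set_borel_measurable lborel {0..pi} v \<and>
                 set_integrable lborel {0..pi} (\<lambda>x. (norm (v x))\<^sup>2)}"


(* The numbers lambda_k(0): eigenvalues of  y |-> ((0,1),(-1,0)) y'  on [0,pi] with
   y_1(0) sin alpha + y_2(0) cos alpha = 0  and  y_1(pi) sin beta + y_2(pi) cos beta = 0. *)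
definition lambda0 :: "real \<Rightarrow> real \<Rightarrow> int \<Rightarrow> real" where
  "lambda0 \<alpha> \<beta> k = of_int k + (\<alpha> - \<beta>) / pi"

definition v_plus :: "(real \<Rightarrow> complex ^ 2) \<Rightarrow> real \<Rightarrow> complex" where
  "v_plus v x = v x $ 1 + \<i> * v x $ 2"

definition v_minus :: "(real \<Rightarrow> complex ^ 2) \<Rightarrow> real \<Rightarrow> complex" where
  "v_minus v x = v x $ 1 - \<i> * v x $ 2"

definition fourier_0_pi :: "(real \<Rightarrow> complex) \<Rightarrow> complex \<Rightarrow> complex" where
  "fourier_0_pi w z = (LBINT x:{0..pi}. exp (- \<i> * z * of_real x) * w x)"

definition Phi_fun :: "(real \<Rightarrow> complex) \<Rightarrow> complex \<Rightarrow> complex" where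
  "Phi_fun w z =
     (LBINT x:{0..pi}. (LBINT t:{0..x}. exp (- \<i> * z * of_real (x - t)) * cnj (w t)) * w x)"

definition R_fun :: "real \<Rightarrow> (real \<Rightarrow> complex ^ 2) \<Rightarrow> complex \<Rightarrow> complex" where
  "R_fun \<alpha> v z =
     Phi_fun (v_plus v) z + conj_fun (Phi_fun (v_minus v)) (- z)
     + exp (2 * \<i> * of_real \<alpha>) * fourier_0_pi (v_plus v) z
         * conj_fun (fourier_0_pi (v_minus v)) (- z)"

(* The characteristic function Delta(mu,z) of the rank-one perturbation
   D(mu,v) y = ((0,1),(-1,0)) y' + mu <y,v> v
   under the boundary conditions stated at lambda0. *)
definition char_fun ::
    "real \<Rightarrow> real \<Rightarrow> real \<Rightarrow> (real \<Rightarrow> complex ^ 2) \<Rightarrow> complex \<Rightarrow> complex" where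
  "char_fun \<alpha> \<beta> \<mu> v z =
     sin (z * of_real pi - of_real \<alpha> + of_real \<beta>)
     - of_real \<mu> / 4 *
       (exp (\<i> * (z * of_real pi + of_real \<beta> - of_real \<alpha>)) * R_fun \<alpha> v z
        + exp (- \<i> * (z * of_real pi + of_real \<beta> - of_real \<alpha>)) * conj_fun (R_fun \<alpha> v) z)"


definition exponential_type :: "(complex \<Rightarrow> complex) \<Rightarrow> real \<Rightarrow> bool" where
  "exponential_type f \<sigma> \<longleftrightarrow>
     (\<forall>\<epsilon>>0. \<exists>C. \<forall>z. norm (f z) \<le> C * exp ((\<sigma> + \<epsilon>) * norm z))"

definition consecutive_in :: "real set \<Rightarrow> real \<Rightarrow> real \<Rightarrow> bool" where
  "consecutive_in S x y \<longleftrightarrow> x \<in> S \<and> y \<in> S \<and> x < y \<and> S \<inter> {x<..<y} = {}"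

definition interlaced :: "real set \<Rightarrow> real set \<Rightarrow> bool" where
  "interlaced A B \<longleftrightarrow> A \<inter> B = {}
     \<and> (\<forall>x y. consecutive_in A x y \<longrightarrow> (\<exists>!b. b \<in> B \<and> x < b \<and> b < y))
     \<and> (\<forall>x y. consecutive_in B x y \<longrightarrow> (\<exists>!a. a \<in> A \<and> x < a \<and> a < y))"

(* The zeros of f counted with multiplicity are the multiset sum of the sets A0 and B1;
   zorder f z = 0 wherever the analytic function f does not vanish. *)
definition partially_interlaces ::
    "(int \<Rightarrow> real) \<Rightarrow> (complex \<Rightarrow> complex) \<Rightarrow> bool" where
  "partially_interlaces l f \<longleftrightarrow>
     (\<exists>A0 A1 B1 :: real set.
        A0 \<union> A1 = range l \<and> A0 \<inter> A1 = {} \<and> interlaced A1 B1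
        \<and> (\<forall>z. zorder f z = of_bool (z \<in> of_real ` A0) + of_bool (z \<in> of_real ` B1))
        \<and> finite (A0 \<inter> B1))"

definition F_fun :: "real \<Rightarrow> real \<Rightarrow> (complex \<Rightarrow> complex) \<Rightarrow> complex \<Rightarrow> complex" where
  "F_fun \<alpha> \<beta> f z = f z / sin (z * of_real pi - of_real \<alpha> + of_real \<beta>)"

definition class_J :: "real \<Rightarrow> real \<Rightarrow> (complex \<Rightarrow> complex) set" where
  "class_J \<alpha> \<beta> = {f.
      f holomorphic_on UNIV \<and> (\<exists>\<sigma>\<le>pi. exponential_type f \<sigma>)
    \<and> bounded (f ` \<real>) \<and> f 0 \<noteq> 0 \<and> conj_fun f = f
    \<and> (\<forall>z. f z = 0 \<longrightarrow> z \<in> \<real> \<and>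
          (zorder f z = 1 \<or> zorder f z = 2 \<and> z \<in> range (\<lambda>s. of_real (lambda0 \<alpha> \<beta> s))))
    \<and> finite {z. f z = 0 \<and> zorder f z = 2}
    \<and> partially_interlaces (lambda0 \<alpha> \<beta>) f
    \<and> ((\<lambda>y::real. F_fun \<alpha> \<beta> f (\<i> * of_real y)) \<longlongrightarrow> 1) at_top
    \<and> (\<exists>L. ((\<lambda>y::real. y * norm (F_fun \<alpha> \<beta> f (\<i> * of_real y) - 1)) \<longlongrightarrow> L) at_top)}"

end

(* Write l_k for the numbers lambda0 alpha beta k, s(z) = sin (pi z - alpha + beta) and F = Delta / s.
   By the Phragmen-Lindelof principle |Delta(z)| <= M exp (pi |Im z|), so the residue theorem on circles
   through the midpoints between the poles expands F(z) - F(w) into the partial fractions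
   sum r_k (1/(z - l_k) - 1/(w - l_k)) with r_k = Delta(l_k) / s'(l_k). Partial interlacing forces all
   r_k to have the same sign; hence the boundedness of y |F(iy) - 1| gives the convergence of sum |r_k|,
   and F(iy) -> 1 gives F(z) = 1 + sum r_k / (z - l_k).
   For the real trigonometric vector with v_1 + i v_2 = sum a_k exp (i (l_k x - alpha)) the characteristic
   function equals s(z) (1 - sum mu pi a_k^2 / (z - l_k)), so mu = -1 or 1 and pi a_k^2 = |r_k| solve the
   problem; for infinite sums v is the limit of a subsequence of partial sums dominated by an L^2 function. *)
theory Submission
  imports Defs "HOL-Real_Asymp.Real_Asymp"
begin

section \<open>A Phragmen-Lindelof principle\<close>

text \<open>The construction is the resolvent formula of a rank-one perturbation. The functions y_k
  = (cos (l_k x - \<alpha>), sin (l_k x - \<alpha>)) are eigenfunctions of the unperturbed operator,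
  each of squared norm pi, so for v = sum a_k y_k the characteristic function divided by s should be
  1 + \<mu> <(D_0 - z)^(-1) v, v> = 1 - sum \<mu> pi a_k^2 / (z - l_k). All these residues have the
  sign of -\<mu>; hence one-signedness is what interlacing has to supply, and after scaling v only
  the sign of \<mu> is left to choose. The obstacle is that the characteristic function is given by
  integrals, the one in Phi being iterated and quadratic in v. The formula is computed for finite
  sums, and the convergence in mean of v is strengthened to almost everywhere convergence under one
  majorant, so that limits may be taken inside both integrals. The identity with Delta is obtained
  off the real axis, where no denominator vanishes, and reaches the real points by
  continuity.\<close>

lemma Re_three_halves_power_ge:
  fixes w :: complex
  assumes "Re w > 0" "Im w > 0"
  shows "Re (exp (3/2 * (Ln w - \<i> * of_real (pi/4)))) \<ge> cos (3*pi/8) * norm w powr (3/2)"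
proof -
  have w0: "w \<noteq> 0" using assms by auto
  have a: "\<bar>Im (Ln w) - pi/4\<bar> \<le> pi/4"
  proof -
    have "0 < Im (Ln w)" "Im (Ln w) < pi" using assms Im_Ln_pos_lt[OF w0] by auto
    moreover have "\<bar>Im (Ln w)\<bar> < pi/2" using assms Re_Ln_pos_lt[OF w0] by auto
    ultimately show ?thesis by linarith
  qed
  have c: "cos (3*pi/8) \<le> cos (3/2 * (Im (Ln w) - pi/4))"
  proof -
    have "3/2 * (Im (Ln w) - pi/4) \<le> 3*pi/8" "- (3/2 * (Im (Ln w) - pi/4)) \<le> 3*pi/8"
      using a unfolding abs_le_iff by argo+
    hence "\<bar>3/2 * (Im (Ln w) - pi/4)\<bar> \<le> 3*pi/8" by (rule abs_leI)
    hence "cos (3*pi/8) \<le> cos \<bar>3/2 * (Im (Ln w) - pi/4)\<bar>"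
      by (intro cos_monotone_0_pi_le) auto
    thus ?thesis by (simp only: cos_abs_real)
  qed
  have "exp (3/2 * ln (norm w)) = norm w powr (3/2)" using w0 by (simp add: powr_def)
  hence "Re (exp (3/2 * (Ln w - \<i> * of_real (pi/4)))) = norm w powr (3/2) * cos (3/2 * (Im (Ln w) - pi/4))"
    using w0 by (simp add: Re_exp)
  thus ?thesis using c mult_right_mono[OF c, of "norm w powr (3/2)"] by (simp add: mult.commute)
qed

text \<open>The damping factor is exp (-e p), with p the power 3/2 of the variable rotated by -pi/4.
  The exponent 3/2 lies between the order 1 of the growth of \<open>f\<close> and the critical order
  2 of a quadrant: the rotated arguments, at most pi/4, become at most 3 pi/8 < pi/2, so Re p grows
  like |z|^(3/2) and beats exp (c |z|). The maximum principle on a large quarter disc gives the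
  bound M exp (e Re p), and then e tends to 0.\<close>

lemma phragmen_lindelof_quadrant:
  fixes f :: "complex \<Rightarrow> complex"
  assumes hol: "f holomorphic_on UNIV" and growth: "\<And>z. norm (f z) \<le> C * exp (c * norm z)"
    and re: "\<And>x. x \<ge> 0 \<Longrightarrow> norm (f (of_real x)) \<le> M"
    and im: "\<And>y. y \<ge> 0 \<Longrightarrow> norm (f (\<i> * of_real y)) \<le> M"
    and M: "M > 0" and z: "Re z \<ge> 0" "Im z \<ge> 0"
  shows "norm (f z) \<le> M"
proof -
  \<comment> \<open>The shift by 1 + \<i> moves the branch point out of the closed quadrant, so that
    \<open>p\<close> is holomorphic in a neighbourhood of it.\<close>
  define p where "p = (\<lambda>z. exp (3/2 * (Ln (z + 1 + \<i>) - \<i> * of_real (pi/4))))"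
  define d where "d = cos (3*pi/8)"
  have d: "d > 0" unfolding d_def by (rule cos_gt_zero) auto
  have p_ge: "Re (p w) \<ge> d * norm w powr (3/2)" if "Re w \<ge> 0" "Im w \<ge> 0" for w
  proof -
    have "norm w \<le> norm (w + 1 + \<i>)"
      unfolding cmod_def using that by (intro real_sqrt_le_mono add_mono power_mono) auto
    hence "norm w powr (3/2) \<le> norm (w + 1 + \<i>) powr (3/2)" by (intro powr_mono2) auto
    thus ?thesis using Re_three_halves_power_ge[of "w + 1 + \<i>"] that d
      unfolding p_def d_def by (smt (verit) mult_left_mono complex.sel plus_complex.sel imaginary_unit.sel one_complex.sel)
  qed
  have p_nonneg: "Re (p w) \<ge> 0" if "Re w \<ge> 0" "Im w \<ge> 0" for w
    using p_ge[OF that] d by (smt (verit) mult_nonneg_nonneg powr_ge_zero)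
  have key: "norm (f z) \<le> M * exp (e * Re (p z))" if e: "e > 0" for e
  proof -
    define K where "K = e * d"
    have "K > 0" using e d by (simp add: K_def)
    hence "((\<lambda>R::real. exp (c * R - K * R powr (3/2))) \<longlongrightarrow> 0) at_top"
      by real_asymp
    hence "((\<lambda>R::real. C * exp (c * R - (e*d) * R powr (3/2))) \<longlongrightarrow> 0) at_top"
      unfolding K_def by (rule tendsto_mult_right_zero)
    hence "eventually (\<lambda>R::real. C * exp (c * R - (e*d) * R powr (3/2)) < M) at_top"
      using M by (auto simp: order_tendsto_iff)
    moreover have "eventually (\<lambda>R::real. R > norm z) at_top" by (rule eventually_gt_at_top)
    ultimately obtain R where R: "C * exp (c * R - (e*d) * R powr (3/2)) < M" "R > norm z"
      using eventually_happens[OF eventually_conj] by fastforce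
    define S where "S = {z. Re z \<ge> 0 \<and> Im z \<ge> 0} \<inter> cball 0 R"
    define h where "h = (\<lambda>z. f z * exp (- of_real e * p z))"
    have clS: "closed S" unfolding S_def
      by (intro closed_Int closed_cball closed_Collect_conj closed_Collect_le continuous_intros)
    have holh: "h holomorphic_on {z. Re z > -1 \<and> Im z > -1}"
      unfolding h_def p_def
      by (intro holomorphic_intros holomorphic_on_subset[OF hol]) (auto simp: complex_nonpos_Reals_iff)
    have nh: "norm (h w) = norm (f w) * exp (- e * Re (p w))" for w
      by (simp add: h_def norm_mult)
    have "norm (h z) \<le> M"
    proof (rule maximum_modulus_frontier[of h S])
      show "h holomorphic_on interior S"
        by (rule holomorphic_on_subset[OF holh]) (use interior_subset in \<open>fastforce simp: S_def\<close>)
      show "continuous_on (closure S) h"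
        by (rule holomorphic_on_imp_continuous_on, rule holomorphic_on_subset[OF holh])
          (use clS in \<open>auto simp: S_def\<close>)
      show "bounded S" unfolding S_def by (rule bounded_Int) auto
      show "z \<in> S" using z R by (auto simp: S_def)
      fix w assume w: "w \<in> frontier S"
      hence wS: "w \<in> S" "w \<notin> interior S" using clS by (auto simp: frontier_def)
      have "Re w = 0 \<or> Im w = 0 \<or> norm w = R"
      proof (rule ccontr)
        assume "\<not> ?thesis"
        hence "w \<in> {z. Re z > 0 \<and> Im z > 0} \<inter> ball 0 R" using wS by (auto simp: S_def)
        moreover have "open ({z. Re z > 0 \<and> Im z > 0} \<inter> ball 0 R)"
          by (intro open_Int open_ball open_Collect_conj open_Collect_less continuous_intros)
        moreover have "{z. Re z > 0 \<and> Im z > 0} \<inter> ball 0 R \<subseteq> S" by (auto simp: S_def)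
        ultimately show False using wS interiorI by blast
      qed
      thus "norm (h w) \<le> M"
      proof (elim disjE)
        assume "Re w = 0"
        hence "norm (f w) \<le> M" using im[of "Im w"] wS by (auto simp: S_def complex_eq_iff intro: back_subst[of "\<lambda>w. norm (f w) \<le> M"])
        moreover have "exp (- e * Re (p w)) \<le> 1" using p_nonneg[of w] wS e by (auto simp: S_def)
        ultimately show ?thesis unfolding nh by (smt (verit) M mult_left_le norm_ge_zero)
      next
        assume "Im w = 0"
        hence "norm (f w) \<le> M" using re[of "Re w"] wS by (auto simp: S_def complex_eq_iff intro: back_subst[of "\<lambda>w. norm (f w) \<le> M"])
        moreover have "exp (- e * Re (p w)) \<le> 1" using p_nonneg[of w] wS e by (auto simp: S_def)
        ultimately show ?thesis unfolding nh by (smt (verit) M mult_left_le norm_ge_zero)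
      next
        assume wR: "norm w = R"
        have "norm (h w) \<le> C * exp (c * R) * exp (- e * Re (p w))"
          unfolding nh using growth[of w] wR by (intro mult_right_mono) auto
        also have "\<dots> \<le> C * exp (c * R) * exp (- (e * d) * R powr (3/2))"
        proof (rule mult_left_mono)
          have "e * (d * R powr (3/2)) \<le> e * Re (p w)" 
            using p_ge[of w] wS e wR by (intro mult_left_mono) (auto simp: S_def)
          thus "exp (- e * Re (p w)) \<le> exp (- (e * d) * R powr (3/2))" by (simp add: mult.assoc)
          show "0 \<le> C * exp (c * R)" using order_trans[OF norm_ge_zero growth[of w]] wR by simp
        qed
        also have "\<dots> = C * exp (c * R - (e*d) * R powr (3/2))" by (simp add: exp_diff exp_minus field_simps)
        finally show ?thesis using R by simp
      qed
    qed
    thus ?thesis unfolding nh by (simp add: exp_minus field_simps)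
  qed
  have "((\<lambda>e. M * exp (e * Re (p z))) \<longlongrightarrow> M * exp (0 * Re (p z))) (at_right 0)"
    by (intro tendsto_intros)
  moreover have "eventually (\<lambda>e. norm (f z) \<le> M * exp (e * Re (p z))) (at_right 0)"
    using key by (auto simp: eventually_at_filter)
  ultimately show ?thesis
    using tendsto_lowerbound[of "\<lambda>e. M * exp (e * Re (p z))" "M * exp (0 * Re (p z))" "at_right 0" "norm (f z)"]
    by (simp add: trivial_limit_at_right_real)
qed

section \<open>Partial fractions of a quotient by the sine\<close>

lemma norm_sin_complex_squared: "(norm (sin z))\<^sup>2 = (sin (Re z))\<^sup>2 + (sinh (Im z))\<^sup>2"
proof -
  have "(norm (sin z))\<^sup>2 = (sin (Re z) * cosh (Im z))\<^sup>2 + (cos (Re z) * sinh (Im z))\<^sup>2"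
    by (simp add: cmod_power2 Re_sin Im_sin cosh_def sinh_def)
  also have "\<dots> = (sin (Re z))\<^sup>2 * (1 + (sinh (Im z))\<^sup>2) + (1 - (sin (Re z))\<^sup>2) * (sinh (Im z))\<^sup>2"
    by (simp add: power_mult_distrib cosh_square_eq cos_squared_eq)
  finally show ?thesis by (simp add: algebra_simps)
qed

lemma norm_sin_ge_real: "norm (sin z) \<ge> \<bar>sin (Re z)\<bar>"
  by (rule power2_le_imp_le) (simp_all add: norm_sin_complex_squared)

lemma norm_sin_ge_sinh: "norm (sin z) \<ge> sinh \<bar>Im z\<bar>"
  by (rule power2_le_imp_le) (simp_all add: norm_sin_complex_squared)

lemma norm_sin_le_exp: "norm (sin z) \<le> exp \<bar>Im z\<bar>"
proof (rule power2_le_imp_le)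
  have "(norm (sin z))\<^sup>2 \<le> 1 + (sinh \<bar>Im z\<bar>)\<^sup>2"
    by (simp add: norm_sin_complex_squared abs_square_le_1)
  also have "\<dots> = (cosh \<bar>Im z\<bar>)\<^sup>2" by (simp add: cosh_square_eq)
  also have "\<dots> \<le> (exp \<bar>Im z\<bar>)\<^sup>2" by (intro power_mono) (simp_all add: cosh_def)
  finally show "(norm (sin z))\<^sup>2 \<le> (exp \<bar>Im z\<bar>)\<^sup>2" .
qed simp

text \<open>From exp (2 t) >= 3/2 follows exp (-t) <= 2/3 exp t; half of the remaining third of exp
  t is the constant 1/6. The threshold pi/4 is the value of pi |Im z| at |Im z| = 1/4, where the
  estimate on circles changes its method.\<close>

lemma sinh_ge_exp:
  fixes t :: real
  assumes "t \<ge> pi/4"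
  shows "sinh t \<ge> exp t / 6"
proof -
  have "1/2 \<le> t" using assms pi_gt3 by simp
  hence "exp 1 \<le> exp (2 * t)" by simp
  hence "3/2 \<le> exp (2*t)" using exp_ge_add_one_self[of "1::real"] by linarith
  hence "exp (-t) * (3/2) \<le> exp (-t) * exp (2*t)" by (intro mult_left_mono) auto
  also have "\<dots> = exp t" by (simp flip: exp_add)
  finally show ?thesis by (simp add: sinh_def)
qed

text \<open>Away from the real axis the hyperbolic sine dominates. For |Im z| < 1/4 the circle stays
  between the abscissae N + 1/4 and N + 1/2 in absolute value; there the sine of pi Re z is at least
  cos (pi/4) >= 1/2 in modulus, while exp (pi |Im z|) is at most 3.\<close>

lemma norm_sin_pi_ge_on_circle:
  assumes z: "norm z = of_nat N + 1/2"
  shows "norm (sin (of_real pi * z)) \<ge> exp (pi * \<bar>Im z\<bar>) / 6"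
proof (cases "\<bar>Im z\<bar> \<ge> 1/4")
  case True
  hence "exp (pi * \<bar>Im z\<bar>) / 6 \<le> sinh (pi * \<bar>Im z\<bar>)" by (intro sinh_ge_exp) auto
  also have "\<dots> \<le> norm (sin (of_real pi * z))" using norm_sin_ge_sinh[of "of_real pi * z"] by (simp add: abs_mult)
  finally show ?thesis .
next
  case False
  define x where "x = \<bar>Re z\<bar>"
  have x2: "x\<^sup>2 + (Im z)\<^sup>2 = (N + 1/2)\<^sup>2" unfolding x_def z[symmetric] by (simp add: cmod_power2)
  have x1: "x \<le> N + 1/2" using abs_Re_le_cmod[of z] z by (simp add: x_def)
  have x0: "x \<ge> N + 1/4"
  proof (rule ccontr)
    assume "\<not> ?thesis"
    hence "x\<^sup>2 \<le> (N + 1/4)\<^sup>2" by (intro power_mono) (auto simp: x_def)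
    moreover have "\<bar>Im z\<bar>\<^sup>2 \<le> (1/4)\<^sup>2" using False by (intro power_mono) auto
    moreover have "(N + 1/4)\<^sup>2 + (1/4)\<^sup>2 < (N + 1/2 :: real)\<^sup>2" by (simp add: power2_eq_square field_simps)
    ultimately show False using x2 by simp
  qed
  define t where "t = N + 1/2 - x"
  have t: "0 \<le> t" "t \<le> 1/4" using x0 x1 by (auto simp: t_def)
  have "sin (pi * x) = sin ((pi/2 - pi * t) + of_nat N * pi)" by (simp add: t_def algebra_simps)
  also have "\<bar>\<dots>\<bar> = \<bar>cos (pi * t)\<bar>" by (simp add: sin_add sin_diff cos_diff abs_mult)
  finally have s: "\<bar>sin (pi * x)\<bar> = \<bar>cos (pi * t)\<bar>" .
  have "cos (pi/4) \<le> cos (pi * t)" using t by (intro cos_monotone_0_pi_le) auto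
  moreover have "cos (pi/4) \<ge> 1/2" by (simp add: cos_45 real_le_rsqrt)
  ultimately have s2: "\<bar>sin (pi * x)\<bar> \<ge> 1/2" using s by linarith
  have "exp (pi * \<bar>Im z\<bar>) \<le> exp 1" using False pi_less_4
    mult_mono[of pi 4 "\<bar>Im z\<bar>" "1/4"] by simp
  also have "\<dots> \<le> 3" by (rule exp_le)
  finally have "exp (pi * \<bar>Im z\<bar>) / 6 \<le> \<bar>sin (pi * x)\<bar>" using s2 by linarith
  also have "\<dots> = \<bar>sin (pi * Re z)\<bar>" unfolding x_def by (cases "Re z \<ge> 0") auto
  also have "\<dots> \<le> norm (sin (of_real pi * z))" using norm_sin_ge_real[of "of_real pi * z"] by simp
  finally show ?thesis .
qed

lemma sin_pi_times_eq_0_iff: "sin (of_real pi * z) = 0 \<longleftrightarrow> z \<in> \<int>" for z :: complex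
  by (auto simp: sin_eq_0 Ints_def)

lemma cos_pi_int_complex: "cos (of_real pi * of_int k :: complex) = of_real (cos (pi * of_int k))"
  by (metis cos_of_real of_real_mult of_real_of_int_eq)

text \<open>The derivative of the sine at the pole is pi cos (pi k), and cos (pi k) is its own
  inverse, which puts it into the numerator.\<close>

lemma residue_div_sin_pi:
  assumes "open S" "of_int k \<in> S" "Q holomorphic_on S" "S \<inter> \<int> \<subseteq> {of_int k}"
  shows "residue (\<lambda>u. Q u / sin (of_real pi * u)) (of_int k) =
         of_real (cos (pi * of_int k)) * Q (of_int k) / of_real pi"
proof (rule residue_simple'[OF assms(1,2)])
  show "(\<lambda>u. Q u / sin (of_real pi * u)) holomorphic_on S - {of_int k}"
    using assms by (intro holomorphic_intros holomorphic_on_subset[OF assms(3)])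
      (auto simp: sin_pi_times_eq_0_iff)
  define c where "c = (of_real (cos (pi * of_int k)) :: complex)"
  have cc: "c * c = 1" by (auto simp: c_def)
  hence c0: "c \<noteq> 0" by auto
  have "((\<lambda>u. sin (of_real pi * u)) has_field_derivative (of_real pi * c)) (at (of_int k))"
    by (auto intro!: derivative_eq_intros simp: c_def cos_pi_int_complex)
  moreover have "sin (of_real pi * of_int k :: complex) = 0" by (simp add: sin_pi_times_eq_0_iff)
  ultimately have "((\<lambda>u. sin (of_real pi * u) / (u - of_int k)) \<longlongrightarrow> of_real pi * c) (at (of_int k))"
    by (simp add: has_field_derivative_iff)
  moreover have "(Q \<longlongrightarrow> Q (of_int k)) (at (of_int k))"
    using assms continuous_on_eq_continuous_at holomorphic_on_imp_continuous_on isContD by blast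
  ultimately have lim: "((\<lambda>u. Q u / (sin (of_real pi * u) / (u - of_int k))) \<longlongrightarrow> Q (of_int k) / (of_real pi * c)) (at (of_int k))"
    using c0 by (intro tendsto_intros) auto
  have eq1: "Q (of_int k) / (of_real pi * c) = c * Q (of_int k) / of_real pi"
    using cc c0 by (simp add: field_simps)
  have eq2: "(\<lambda>u. Q u / (sin (of_real pi * u) / (u - of_int k))) =
      (\<lambda>w. Q w / sin (of_real pi * w) * (w - of_int k))" by (simp add: fun_eq_iff)
  show "((\<lambda>w. Q w / sin (of_real pi * w) * (w - of_int k)) \<longlongrightarrow>
       of_real (cos (pi * of_int k)) * Q (of_int k) / of_real pi) (at (of_int k))"
    using lim[unfolded eq1 eq2] unfolding c_def .
qed

text \<open>On the circles \<open>F\<close> is merely bounded: the growth exp (pi |Im u|) cancels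
  between \<open>D\<close> and the sine, leaving 6 M. A single Cauchy kernel would give an integral
  that need not tend to 0; with the product kernel 1 / ((u - z) (u - w)) it is of order 1/N. The
  residues at \<open>z\<close> and \<open>w\<close> combine to the difference quotient of
  \<open>F\<close>.\<close>

lemma sin_quotient_residue_sum_bound:
  fixes D :: "complex \<Rightarrow> complex"
  assumes D: "D holomorphic_on UNIV" and bd: "\<And>u. norm (D u) \<le> M * exp (pi * \<bar>Im u\<bar>)"
    and zw: "z \<notin> \<int>" "w \<notin> \<int>" "z \<noteq> w" and N: "norm z < real N" "norm w < real N"
  defines "F \<equiv> \<lambda>u. D u / sin (of_real pi * u)"
  shows "norm (F z / (z - w) + F w / (w - z) + (\<Sum>k\<in>{-int N..int N}.
           of_real (cos (pi * of_int k)) * D (of_int k) / of_real pi / ((of_int k - z) * (of_int k - w))))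
         \<le> 6 * M * (N + 1/2) / ((N + 1/2 - norm z) * (N + 1/2 - norm w))"
proof -
  define R where "R = N + 1/2"
  define f where "f = (\<lambda>u. D u / (sin (of_real pi * u) * ((u - z) * (u - w))))"
  define K :: "complex set" where "K = of_int ` {-int N..int N}"
  \<comment> \<open>The radius N + 1 lets in exactly the integers of modulus at most N and still
    leaves room for the circle of radius N + 1/2.\<close>
  define S :: "complex set" where "S = ball 0 (N + 1)"
  define g where "g = circlepath 0 R"
  have M0: "M \<ge> 0" using order_trans[OF norm_ge_zero bd[of 0]] by simp
  have R: "R > 0" "norm z < R" "norm w < R" using N by (auto simp: R_def)
  have intS: "S \<inter> \<int> = K"
  proof -
    have *: "of_int k \<in> S \<longleftrightarrow> k \<in> {-int N..int N}" for k
    proof -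
      have "of_int k \<in> S \<longleftrightarrow> \<bar>of_int k :: real\<bar> < real N + 1"
        by (simp add: S_def add.commute)
      also have "\<dots> \<longleftrightarrow> \<bar>k\<bar> < int N + 1" by linarith
      finally show ?thesis by auto
    qed
    have "x \<in> S \<inter> \<int> \<longleftrightarrow> x \<in> K" for x
    proof
      assume "x \<in> S \<inter> \<int>"
      then obtain k where "x = of_int k" "of_int k \<in> S" by (auto elim: Ints_cases)
      thus "x \<in> K" unfolding K_def using * by blast
    next
      assume "x \<in> K"
      then obtain k where "x = of_int k" "k \<in> {-int N..int N}" unfolding K_def by blast
      thus "x \<in> S \<inter> \<int>" using *[of k] by simp
    qed
    thus ?thesis by blast
  qed
  have zK: "z \<notin> K" "w \<notin> K" using zw by (auto simp: K_def)
  have onK: "sin (of_real pi * u) \<noteq> 0" if "u \<in> S" "u \<notin> K" for u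
    using that intS by (auto simp: sin_pi_times_eq_0_iff)
  have sph: "sphere 0 R \<subseteq> S - (K \<union> {z, w})"
  proof
    fix u :: complex assume u: "u \<in> sphere 0 R"
    hence "sin (of_real pi * u) \<noteq> 0"
      using norm_sin_pi_ge_on_circle[of u N] by (auto simp: R_def)
    thus "u \<in> S - (K \<union> {z, w})" using u R intS by (auto simp: R_def S_def sin_pi_times_eq_0_iff)
  qed
  have holf: "f holomorphic_on S - (K \<union> {z, w})"
    unfolding f_def using onK by (intro holomorphic_intros holomorphic_on_subset[OF D]) auto
  have wn: "winding_number g p = 1" if "p \<in> K \<union> {z, w}" for p
    unfolding g_def using that R by (intro winding_number_circlepath) (auto simp: K_def R_def)
  have "contour_integral g f = 2 * pi * \<i> * (\<Sum>p\<in>K \<union> {z, w}. winding_number g p * residue f p)"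
  proof (rule Residue_theorem)
    show "\<forall>p. p \<notin> S \<longrightarrow> winding_number g p = 0"
    proof safe
      fix p assume "p \<notin> S"
      thus "winding_number g p = 0" unfolding g_def
        by (intro winding_number_zero_outside[of _ "cball 0 R"]) (use R in \<open>auto simp: S_def R_def\<close>)
    qed
  qed (use holf sph R in \<open>auto simp: S_def K_def g_def\<close>)
  also have "(\<Sum>p\<in>K \<union> {z, w}. winding_number g p * residue f p) = (\<Sum>p\<in>K \<union> {z, w}. residue f p)"
    using wn by (intro sum.cong) auto
  also have "\<dots> = (\<Sum>p\<in>K. residue f p) + residue f z + residue f w"
    using zK zw by (subst sum.union_disjoint) (auto simp: K_def)
  also have "(\<Sum>p\<in>K. residue f p) = (\<Sum>k\<in>{-int N..int N}. residue f (of_int k))"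
    unfolding K_def by (subst sum.reindex) (auto simp: inj_on_def)
  also have "\<dots> = (\<Sum>k\<in>{-int N..int N}.
           of_real (cos (pi * of_int k)) * D (of_int k) / of_real pi / ((of_int k - z) * (of_int k - w)))"
  proof (rule sum.cong, goal_cases)
    case (2 k)
    define Q where "Q = (\<lambda>u. D u / ((u - z) * (u - w)))"
    have "residue (\<lambda>u. Q u / sin (of_real pi * u)) (of_int k) =
         of_real (cos (pi * of_int k)) * Q (of_int k) / of_real pi"
    proof (rule residue_div_sin_pi[of "ball (of_int k) 1 - {z,w}"])
      show "(ball (of_int k) 1 - {z,w}) \<inter> \<int> \<subseteq> {of_int k :: complex}"
      proof
        fix x assume "x \<in> (ball (of_int k) 1 - {z,w}) \<inter> \<int>"
        then obtain j where j: "x = of_int j" "dist (of_int k) (of_int j :: complex) < 1" by (auto simp: Ints_def)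
        hence "norm (of_int (k - j) :: complex) < 1" by (simp add: dist_norm)
        hence "\<bar>of_int (k - j) :: real\<bar> < 1" by (simp only: norm_of_int)
        thus "x \<in> {of_int k}" using j by simp
      qed
      show "Q holomorphic_on ball (of_int k) 1 - {z, w}"
        unfolding Q_def by (intro holomorphic_intros holomorphic_on_subset[OF D]) auto
      show "of_int k \<in> ball (of_int k) 1 - {z, w}" using zw by auto
    qed auto
    moreover have "(\<lambda>u. Q u / sin (of_real pi * u)) = f" by (auto simp: Q_def f_def)
    ultimately show ?case by (simp add: Q_def mult_ac)
  qed auto
  also have "residue f z = F z / (z - w)"
  proof -
    have "residue (\<lambda>u. F u / (u - w) / (u - z)) z = F z / (z - w)"
      by (rule residue_simple[of "S - (K \<union> {w})"])
        (use zK zw R onK in \<open>auto simp: F_def K_def S_def R_def intro!: open_Diff finite_imp_closed holomorphic_intros holomorphic_on_subset[OF D]\<close>)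
    moreover have "(\<lambda>u. F u / (u - w) / (u - z)) = f" by (auto simp: F_def f_def mult_ac)
    ultimately show ?thesis by simp
  qed
  also have "residue f w = F w / (w - z)"
  proof -
    have "residue (\<lambda>u. F u / (u - z) / (u - w)) w = F w / (w - z)"
      by (rule residue_simple[of "S - (K \<union> {z})"])
        (use zK zw R onK in \<open>auto simp: F_def K_def S_def R_def intro!: open_Diff finite_imp_closed holomorphic_intros holomorphic_on_subset[OF D]\<close>)
    moreover have "(\<lambda>u. F u / (u - z) / (u - w)) = f" by (auto simp: F_def f_def mult_ac)
    ultimately show ?thesis by simp
  qed
  finally have eq: "contour_integral g f = 2 * pi * \<i> * (F z / (z - w) + F w / (w - z) + (\<Sum>k\<in>{-int N..int N}.
           of_real (cos (pi * of_int k)) * D (of_int k) / of_real pi / ((of_int k - z) * (of_int k - w))))"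
    (is "_ = _ * ?X") by (simp add: add_ac)
  have "f contour_integrable_on g" unfolding g_def
    by (rule contour_integrable_continuous_circlepath)
      (use sph R in \<open>auto intro!: holomorphic_on_imp_continuous_on holomorphic_on_subset[OF holf]\<close>)
  hence "(f has_contour_integral (2 * pi * \<i> * ?X)) (circlepath 0 R)"
    using eq g_def has_contour_integral_integral by metis
  hence "norm (2 * pi * \<i> * ?X) \<le> 6 * M / ((R - norm z) * (R - norm w)) * (2 * pi * R)"
  proof (rule has_contour_integral_bound_circlepath)
    show "0 \<le> 6 * M / ((R - norm z) * (R - norm w))" using M0 R by auto
    fix u :: complex assume "norm (u - 0) = R"
    hence u: "norm u = R" by simp
    have "norm (f u) = norm (D u) / (norm (sin (of_real pi * u)) * (norm (u - z) * norm (u - w)))"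
      by (simp add: f_def norm_divide norm_mult)
    also have "\<dots> \<le> M * exp (pi * \<bar>Im u\<bar>) / (exp (pi * \<bar>Im u\<bar>) / 6 * ((R - norm z) * (R - norm w)))"
    proof (rule frac_le)
      show "exp (pi * \<bar>Im u\<bar>) / 6 * ((R - norm z) * (R - norm w))
           \<le> norm (sin (of_real pi * u)) * (norm (u - z) * norm (u - w))"
        using norm_sin_pi_ge_on_circle[of u N] u R norm_triangle_ineq2[of u z] norm_triangle_ineq2[of u w]
        by (intro mult_mono) (auto simp: R_def)
    qed (use bd M0 R in auto)
    also have "\<dots> = 6 * M / ((R - norm z) * (R - norm w))" using R by (simp add: divide_simps)
    finally show "norm (f u) \<le> 6 * M / ((R - norm z) * (R - norm w))" .
  qed (use R in auto)
  moreover have "norm (2 * pi * \<i> * x) = 2 * pi * norm x" for x :: complex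
    by (simp add: norm_mult)
  ultimately have "2 * pi * norm ?X \<le> 6 * M / ((R - norm z) * (R - norm w)) * (2 * pi * R)" by (simp only:)
  also have "\<dots> = 2 * pi * (6 * M * R / ((R - norm z) * (R - norm w)))" by (simp add: mult_ac)
  finally have "2 * pi * norm ?X \<le> 2 * pi * (6 * M * R / ((R - norm z) * (R - norm w)))" .
  hence "norm ?X \<le> 6 * M * R / ((R - norm z) * (R - norm w))" by (subst (asm) mult_le_cancel_left_pos) auto
  thus ?thesis by (simp add: R_def)
qed

text \<open>Multiplying the residue identity by z - w turns the product kernel into a difference of
  simple fractions. The sums are symmetric because the circles are centred at 0; no absolute
  convergence is available yet.\<close>

lemma sin_quotient_partial_fractions:
  fixes D :: "complex \<Rightarrow> complex"
  assumes D: "D holomorphic_on UNIV" and bd: "\<And>u. norm (D u) \<le> M * exp (pi * \<bar>Im u\<bar>)"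
    and zw: "z \<notin> \<int>" "w \<notin> \<int>"
  shows "(\<lambda>N. \<Sum>k\<in>{-int N..int N}. of_real (cos (pi * of_int k)) * D (of_int k) / of_real pi *
            (1 / (z - of_int k) - 1 / (w - of_int k)))
         \<longlonglongrightarrow> D z / sin (of_real pi * z) - D w / sin (of_real pi * w)"
proof (cases "z = w")
  case False
  define F where "F = (\<lambda>u. D u / sin (of_real pi * u))"
  define r where "r = (\<lambda>k::int. of_real (cos (pi * of_int k)) * D (of_int k) / of_real pi)"
  define X where "X = (\<lambda>N. F z / (z - w) + F w / (w - z) + (\<Sum>k\<in>{-int N..int N}. r k / ((of_int k - z) * (of_int k - w))))"
  have "eventually (\<lambda>N. norm (X N) \<le> 6 * M * (real N + 1/2) / ((real N + 1/2 - norm z) * (real N + 1/2 - norm w))) sequentially"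
    using filterlim_real_sequentially[unfolded filterlim_at_top_dense, rule_format, of "norm z"]
      filterlim_real_sequentially[unfolded filterlim_at_top_dense, rule_format, of "norm w"]
  proof eventually_elim
    case (elim N)
    thus ?case using sin_quotient_residue_sum_bound[OF D bd zw False] by (simp add: X_def F_def r_def)
  qed
  moreover have "(\<lambda>N. 6 * M * (real N + 1/2) / ((real N + 1/2 - norm z) * (real N + 1/2 - norm w))) \<longlonglongrightarrow> 0"
    by real_asymp
  ultimately have "X \<longlonglongrightarrow> 0" by (rule Lim_null_comparison)
  hence "(\<lambda>N. F z - F w - (z - w) * X N) \<longlonglongrightarrow> F z - F w - (z - w) * 0" by (intro tendsto_intros)
  moreover have "F z - F w - (z - w) * X N = (\<Sum>k\<in>{-int N..int N}. r k * (1 / (z - of_int k) - 1 / (w - of_int k)))" for N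
  proof -
    have "(z - w) * X N = F z - F w + (\<Sum>k\<in>{-int N..int N}. (z - w) * (r k / ((of_int k - z) * (of_int k - w))))"
      using False by (simp add: X_def distrib_left sum_distrib_left) (simp add: field_simps)
    also have "(\<Sum>k\<in>{-int N..int N}. (z - w) * (r k / ((of_int k - z) * (of_int k - w)))) =
               (\<Sum>k\<in>{-int N..int N}. - (r k * (1 / (z - of_int k) - 1 / (w - of_int k))))"
    proof (rule sum.cong, goal_cases)
      case (2 k)
      have "z - of_int k \<noteq> 0" "w - of_int k \<noteq> 0" "of_int k - z \<noteq> 0" "of_int k - w \<noteq> 0" using zw by auto
      thus ?case by (simp add: divide_simps) (simp add: algebra_simps)
    qed auto
    finally show ?thesis by (simp add: sum_negf)
  qed
  ultimately show ?thesis by (simp add: F_def r_def)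
qed auto

section \<open>Signs of the residues\<close>

text \<open>Equal orders give the quotient order 0, so its local factorisation consists of the
  non-vanishing factor \<open>zor_poly\<close> alone, whose value at \<open>x\<close> is the
  limit.\<close>

lemma quotient_zorder_eq_imp_tendsto:
  fixes f g :: "complex \<Rightarrow> complex"
  assumes hol: "f holomorphic_on UNIV" "g holomorphic_on UNIV"
    and nz: "f u \<noteq> 0" "g v \<noteq> 0" and ord: "zorder f x = zorder g x"
  obtains c where "c \<noteq> 0" "((\<lambda>w. f w / g w) \<longlongrightarrow> c) (at x)" "isolated_singularity_at (\<lambda>w. f w / g w) x"
proof -
  have ev: "eventually (\<lambda>w. f w \<noteq> 0) (at x)" "eventually (\<lambda>w. g w \<noteq> 0) (at x)"
    using non_zero_neighbour_alt[OF hol(1) _ _ _ _ nz(1), of x] non_zero_neighbour_alt[OF hol(2) _ _ _ _ nz(2), of x]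
    by (auto elim: eventually_mono)
  have an: "f analytic_on {x}" "g analytic_on {x}"
    using hol by (auto intro: analytic_on_subset[of _ UNIV] simp: analytic_on_open)
  have iso: "isolated_singularity_at f x" "isolated_singularity_at g x"
    using an isolated_singularity_at_analytic by blast+
  have ness: "not_essential f x" "not_essential g x" using an not_essential_analytic by blast+
  define q where "q = (\<lambda>w. f w / g w)"
  have evq: "eventually (\<lambda>w. q w \<noteq> 0) (at x)" using ev by eventually_elim (auto simp: q_def)
  have q: "isolated_singularity_at q x" "not_essential q x"
    unfolding q_def using iso ness by (auto intro: singularity_intros)
  have zq: "zorder q x = 0"
    using zorder_divide[OF an(1)[THEN analytic_on_imp_meromorphic_on] _ an(2)[THEN analytic_on_imp_meromorphic_on]]
      ev ord unfolding q_def by (simp add: eventually_frequently)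
  obtain r where r: "zor_poly q x x \<noteq> 0" "r > 0" "zor_poly q x holomorphic_on cball x r"
     "\<And>w. w \<in> cball x r - {x} \<Longrightarrow> q w = zor_poly q x w * (w - x) powi 0"
    using zorder_exist[OF q] evq zq by (auto simp: eventually_frequently)
  have "isCont (zor_poly q x) x"
    using r(2,3) by (meson ball_subset_cball centre_in_ball continuous_on_eq_continuous_at
       continuous_on_subset holomorphic_on_imp_continuous_on open_ball)
  hence "(zor_poly q x \<longlongrightarrow> zor_poly q x x) (at x)" by (simp add: isCont_def)
  moreover have "eventually (\<lambda>w. w \<in> cball x r - {x}) (at x)"
    using eventually_at_in_open[of "ball x r" x] r(2) by (auto elim!: eventually_mono)
  hence "eventually (\<lambda>w. zor_poly q x w = q w) (at x)" by eventually_elim (use r(4) in auto)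
  ultimately have "(q \<longlongrightarrow> zor_poly q x x) (at x)" by (rule Lim_transform_eventually)
  thus ?thesis using that r(1) q(1) unfolding q_def by blast
qed

text \<open>After removing its singularities, the quotient is real, continuous and free of zeros on the interval.\<close>
lemma quotient_limits_same_sign:
  fixes f g :: "complex \<Rightarrow> complex"
  assumes hol: "f holomorphic_on UNIV" "g holomorphic_on UNIV"
    and nz: "f u \<noteq> 0" "g v \<noteq> 0"
    and real: "\<And>t::real. f (of_real t) \<in> \<real>" "\<And>t::real. g (of_real t) \<in> \<real>"
    and ab: "a \<le> b"
    and ord: "\<And>t. a \<le> t \<Longrightarrow> t \<le> b \<Longrightarrow> zorder f (of_real t) = zorder g (of_real t)"
    and lim: "((\<lambda>w. f w / g w) \<longlongrightarrow> c) (at (of_real a))" "((\<lambda>w. f w / g w) \<longlongrightarrow> d) (at (of_real b))"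
  shows "Re c * Re d > 0"
proof -
  define q where "q = (\<lambda>w. f w / g w)"
  define G where "G = remove_sings q"
  have G: "G analytic_on {of_real t}" "G (of_real t) \<noteq> 0" "Im (G (of_real t)) = 0"
    if t: "a \<le> t" "t \<le> b" for t
  proof -
    obtain e where e: "e \<noteq> 0" "(q \<longlongrightarrow> e) (at (of_real t))" "isolated_singularity_at q (of_real t)"
      using quotient_zorder_eq_imp_tendsto[OF hol nz ord[OF t]] unfolding q_def by blast
    have eq: "G (of_real t) = e" unfolding G_def using e by (intro remove_sings_eqI)
    show "G analytic_on {of_real t}" unfolding G_def using e by (intro remove_sings_analytic_at)
    show "G (of_real t) \<noteq> 0" using e eq by simp
    \<comment> \<open>The limit may be taken along the real axis, where the quotient is real, so the
      extended value is real too.\<close>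
    have "filterlim of_real (at (of_real t :: complex)) (at t)"
      unfolding filterlim_at by (intro conjI tendsto_of_real tendsto_ident_at) (simp add: eventually_at_filter)
    hence "((\<lambda>s. q (of_real s)) \<longlongrightarrow> e) (at t)" by (rule filterlim_compose[OF e(2)])
    hence "((\<lambda>s. Im (q (of_real s))) \<longlongrightarrow> Im e) (at t)" by (rule tendsto_Im)
    moreover have "Im (q (of_real s)) = 0" for s
      using Reals_divide[OF real(1)[of s] real(2)[of s]] by (simp add: q_def complex_is_Real_iff)
    ultimately show "Im (G (of_real t)) = 0" unfolding eq by (simp add: tendsto_const_iff)
  qed
  define k where "k = (\<lambda>t. Re (G (of_real t)))"
  have k0: "k t \<noteq> 0" if "a \<le> t" "t \<le> b" for t
    using G(2,3)[OF that] by (auto simp: k_def complex_eq_iff)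
  have cont: "isCont k t" if "a \<le> t" "t \<le> b" for t
  proof -
    have "isCont complex_of_real t" by (intro continuous_of_real continuous_ident)
    moreover have "isCont G (of_real t)" using G(1)[OF that] by (rule analytic_at_imp_isCont)
    ultimately have "isCont (\<lambda>t. G (of_real t)) t" by (rule isCont_o2)
    thus ?thesis unfolding k_def by (rule continuous_Re)
  qed
  have "k a * k b > 0"
  proof (rule ccontr)
    assume "\<not> ?thesis"
    hence "k a \<le> 0 \<and> 0 \<le> k b \<or> k b \<le> 0 \<and> 0 \<le> k a"
      by (smt (verit) mult_pos_pos mult_neg_neg)
    hence "\<exists>t. a \<le> t \<and> t \<le> b \<and> k t = 0"
      using IVT[of k a 0 b] IVT2[of k b 0 a] cont ab by blast
    thus False using k0 by blast
  qed
  moreover have "G (of_real a) = c" "G (of_real b) = d"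
    unfolding G_def using lim by (auto simp: q_def intro!: remove_sings_eqI)
  ultimately show ?thesis by (simp add: k_def)
qed

section \<open>Summability of one-signed residues\<close>

text \<open>\<open>has_sum\<close> is a limit along finite subsets, whereas the residue theorem
  delivers symmetric sections. Composition with this filter limit passes from the former to the
  latter.\<close>

lemma filterlim_symmetric_int_intervals:
  "filterlim (\<lambda>N. {-int N..int N}) (finite_subsets_at_top UNIV) sequentially"
  unfolding filterlim_finite_subsets_at_top
proof safe
  fix X :: "int set" assume X: "finite X"
  have "X \<subseteq> {-int N..int N}" if "N \<ge> nat (Max (insert 0 (abs ` X)))" for N
  proof
    fix k assume "k \<in> X"
    hence "\<bar>k\<bar> \<le> Max (insert 0 (abs ` X))" using X by (intro Max_ge) auto
    thus "k \<in> {-int N..int N}" using that by auto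
  qed
  thus "eventually (\<lambda>N. finite {-int N..int N} \<and> X \<subseteq> {-int N..int N} \<and> {-int N..int N} \<subseteq> UNIV) sequentially"
    unfolding eventually_sequentially by (auto intro!: exI[of _ "nat (Max (insert 0 (abs ` X)))"])
qed

lemma summable_on_int_if_symmetric_sums_bounded:
  fixes r :: "int \<Rightarrow> real"
  assumes "\<And>k. r k \<ge> 0" and "\<And>N::nat. (\<Sum>k\<in>{-int N..int N}. r k) \<le> K"
  shows "r summable_on UNIV"
proof (rule nonneg_bdd_above_summable_on)
  show "bdd_above (sum r ` {F. F \<subseteq> UNIV \<and> finite F})"
  proof (rule bdd_aboveI[of _ K], safe)
    fix X :: "int set" assume "finite X"
    hence "eventually (\<lambda>N. X \<subseteq> {-int N..int N}) sequentially"
      using filterlim_symmetric_int_intervals unfolding filterlim_finite_subsets_at_top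
      by (auto elim!: allE[of _ X] eventually_mono)
    then obtain N where "X \<subseteq> {-int N..int N}" by (auto simp: eventually_sequentially)
    hence "sum r X \<le> (\<Sum>k\<in>{-int N..int N}. r k)" using assms(1) by (intro sum_mono2) auto
    thus "sum r X \<le> K" using assms(2)[of N] by linarith
  qed
qed (use assms in auto)

text \<open>All terms are nonnegative, so each finite section is at most h y. After multiplication
  by y every kernel y^2 / (y^2 + l_k^2) tends to 1, and the bound K is inherited by the finite sums
  of \<open>r\<close> themselves.\<close>

lemma Cauchy_transform_bound_imp_summable:
  fixes r l :: "int \<Rightarrow> real"
  assumes r: "\<And>k. r k \<ge> 0"
    and lim: "\<And>y. y > 0 \<Longrightarrow> (\<lambda>N. \<Sum>k\<in>{-int N..int N}. r k * (y / (y\<^sup>2 + (l k)\<^sup>2))) \<longlonglongrightarrow> h y"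
    and bd: "eventually (\<lambda>y. y * h y \<le> K) at_top"
  shows "r summable_on UNIV"
proof (rule summable_on_int_if_symmetric_sums_bounded[OF r])
  fix N :: nat
  define T where "T = (\<lambda>y N. \<Sum>k\<in>{-int N..int N}. r k * (y / (y\<^sup>2 + (l k)\<^sup>2)))"
  have T_le: "T y N \<le> h y" if y: "y > 0" for y
  proof (rule incseq_le)
    show "incseq (T y)" unfolding incseq_def T_def
      using r y by (auto intro!: sum_mono2 mult_nonneg_nonneg divide_nonneg_nonneg add_nonneg_nonneg)
    show "T y \<longlonglongrightarrow> h y" using lim[OF y] by (simp add: T_def)
  qed
  have "((\<lambda>y. \<Sum>k\<in>{-int N..int N}. r k * (y * (y / (y\<^sup>2 + (l k)\<^sup>2)))) \<longlongrightarrow> (\<Sum>k\<in>{-int N..int N}. r k * 1)) at_top"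
  proof (intro tendsto_sum tendsto_mult tendsto_const)
    fix k
    show "((\<lambda>y. y * (y / (y\<^sup>2 + (l k)\<^sup>2))) \<longlongrightarrow> 1) at_top" by real_asymp
  qed
  moreover have "eventually (\<lambda>y. (\<Sum>k\<in>{-int N..int N}. r k * (y * (y / (y\<^sup>2 + (l k)\<^sup>2)))) \<le> K) at_top"
    using bd eventually_gt_at_top[of 0]
  proof eventually_elim
    case (elim y)
    have "(\<Sum>k\<in>{-int N..int N}. r k * (y * (y / (y\<^sup>2 + (l k)\<^sup>2)))) = y * T y N"
      by (simp add: T_def sum_distrib_left mult_ac)
    also have "\<dots> \<le> y * h y" using T_le elim by (intro mult_left_mono) auto
    finally show ?case using elim by linarith
  qed
  ultimately have "(\<Sum>k\<in>{-int N..int N}. r k * 1) \<le> K"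
    by (intro tendsto_upperbound[of _ _ at_top]) auto
  thus "(\<Sum>k\<in>{-int N..int N}. r k) \<le> K" by simp
qed

lemma Im_divide_imaginary_minus_real:
  "Im (of_real a / (\<i> * of_real y - of_real b)) = - (a * (y / (y\<^sup>2 + b\<^sup>2)))"
  by (simp add: Im_divide)

text \<open>At z = \<i> y each fraction has imaginary part -r_k y / (y^2 + l_k^2), while the
  subtracted terms and \<open>F\<close> at the real point \<open>w0\<close> are real and drop out.
  Thus - \<sigma> Im F (\<i> y) is a sum of nonnegative terms, and the growth bound gives
  summability. The sum \<open>S\<close> of the fractions is then at most (sum |r_k|) / |Im z| in
  modulus, F - S takes the same value at all non-real points, and letting y tend to infinity
  identifies that value as 1.\<close>

lemma partial_fractions_one_signed_residues:
  fixes F :: "complex \<Rightarrow> complex" and l r :: "int \<Rightarrow> real" and \<sigma> w0 :: real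
  assumes diff: "\<And>z w. z \<notin> range (\<lambda>k. of_real (l k)) \<Longrightarrow> w \<notin> range (\<lambda>k. of_real (l k)) \<Longrightarrow>
      (\<lambda>N. \<Sum>k\<in>{-int N..int N}. of_real (r k) * (1 / (z - of_real (l k)) - 1 / (w - of_real (l k)))) \<longlonglongrightarrow> F z - F w"
    and w0: "w0 \<notin> range l" "Im (F (of_real w0)) = 0"
    and sgn: "\<bar>\<sigma>\<bar> = 1" "\<And>k. \<sigma> * r k \<ge> 0"
    and lim1: "((\<lambda>y::real. F (\<i> * of_real y)) \<longlongrightarrow> 1) at_top"
    and bd: "eventually (\<lambda>y::real. y * norm (F (\<i> * of_real y) - 1) \<le> K) at_top"
  shows "r summable_on UNIV"
    and "Im z \<noteq> 0 \<Longrightarrow> (\<lambda>N. 1 + (\<Sum>k\<in>{-int N..int N}. of_real (r k) / (z - of_real (l k)))) \<longlonglongrightarrow> F z"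
proof -
  have npole: "z \<notin> range (\<lambda>k. of_real (l k))" if "Im z \<noteq> 0" for z using that by auto
  have w0': "of_real w0 \<notin> range (\<lambda>k. complex_of_real (l k))" using w0 by auto
  have sr: "(\<lambda>k. \<sigma> * r k) summable_on UNIV"
  proof (rule Cauchy_transform_bound_imp_summable[where h = "\<lambda>y. - \<sigma> * Im (F (\<i> * of_real y))" and l = l])
    fix y :: real assume y: "y > 0"
    have "(\<lambda>N. \<Sum>k\<in>{-int N..int N}. of_real (r k) * (1 / (\<i> * of_real y - of_real (l k)) - 1 / (of_real w0 - of_real (l k))))
        \<longlonglongrightarrow> F (\<i> * of_real y) - F (of_real w0)"
      using y by (intro diff w0' npole) simp
    hence "(\<lambda>N. - \<sigma> * Im (\<Sum>k\<in>{-int N..int N}. of_real (r k) * (1 / (\<i> * of_real y - of_real (l k)) - 1 / (of_real w0 - of_real (l k)))))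
        \<longlonglongrightarrow> - \<sigma> * Im (F (\<i> * of_real y) - F (of_real w0))"
      by (intro tendsto_mult tendsto_const tendsto_Im)
    moreover have "- \<sigma> * Im (\<Sum>k\<in>{-int N..int N}. of_real (r k) * (1 / (\<i> * of_real y - of_real (l k)) - 1 / (of_real w0 - of_real (l k))))
        = (\<Sum>k\<in>{-int N..int N}. \<sigma> * r k * (y / (y\<^sup>2 + (l k)\<^sup>2)))" for N
    proof -
      have "Im (of_real (r k) * (1 / (\<i> * of_real y - of_real (l k)) - 1 / (of_real w0 - of_real (l k)))) 
          = - (r k * (y / (y\<^sup>2 + (l k)\<^sup>2)))" for k
      proof -
        have "Im (1 / (of_real w0 - of_real (l k))) = 0" by (simp flip: of_real_diff of_real_divide add: Im_divide_of_real)
        thus ?thesis using Im_divide_imaginary_minus_real[of "r k" y "l k"]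
          by (simp add: right_diff_distrib flip: of_real_diff)
      qed
      thus ?thesis by (simp add: sum_distrib_left sum_negf mult.assoc)
    qed
    ultimately show "(\<lambda>N. \<Sum>k\<in>{-int N..int N}. \<sigma> * r k * (y / (y\<^sup>2 + (l k)\<^sup>2))) \<longlonglongrightarrow> - \<sigma> * Im (F (\<i> * of_real y))"
      using w0 by simp
  next
    show "eventually (\<lambda>y. y * (- \<sigma> * Im (F (\<i> * of_real y))) \<le> K) at_top"
      using bd eventually_gt_at_top[of 0]
    proof eventually_elim
      case (elim y)
      have "- \<sigma> * Im (F (\<i> * of_real y)) \<le> \<bar>\<sigma>\<bar> * \<bar>Im (F (\<i> * of_real y) - 1)\<bar>"
        by (simp flip: abs_mult)
      also have "\<dots> \<le> norm (F (\<i> * of_real y) - 1)" using sgn(1) abs_Im_le_cmod[of "F (\<i> * of_real y) - 1"] by simp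
      finally have "y * (- \<sigma> * Im (F (\<i> * of_real y))) \<le> y * norm (F (\<i> * of_real y) - 1)"
        using elim by (intro mult_left_mono) auto
      thus ?case using elim by linarith
    qed
  qed (use sgn in auto)
  have "(\<lambda>k. \<sigma> * (\<sigma> * r k)) summable_on UNIV" by (intro summable_on_cmult_right sr)
  moreover have "\<sigma> * \<sigma> = 1" using sgn by (auto simp: abs_if split: if_splits)
  ultimately show r: "r summable_on UNIV" by (simp flip: mult.assoc)
  have "\<bar>r k\<bar> = \<sigma> * r k" for k
    using sgn(2)[of k] sgn(1) by (auto simp: abs_if split: if_splits)
  hence absr: "(\<lambda>k. \<bar>r k\<bar>) summable_on UNIV" using sr by simp
  define S :: "complex \<Rightarrow> complex" where "S = (\<lambda>z. \<Sum>\<^sub>\<infinity>k. of_real (r k) / (z - of_real (l k)))"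
  have term_le: "norm (complex_of_real (r k) / (z - of_real (l k))) \<le> \<bar>r k\<bar> / \<bar>Im z\<bar>" if "Im z \<noteq> 0" for z k
  proof -
    have "\<bar>Im z\<bar> \<le> norm (z - of_real (l k))" using abs_Im_le_cmod[of "z - of_real (l k)"] by simp
    thus ?thesis using that by (auto simp: norm_divide intro!: divide_left_mono mult_pos_pos)
  qed
  have abs_summable: "(\<lambda>k. norm (complex_of_real (r k) / (z - of_real (l k)))) summable_on UNIV"
    and Sle: "norm (S z) \<le> (\<Sum>\<^sub>\<infinity>k. \<bar>r k\<bar>) / \<bar>Im z\<bar>" if "Im z \<noteq> 0" for z
  proof -
    have 1: "(\<lambda>k. \<bar>r k\<bar> / \<bar>Im z\<bar>) summable_on UNIV"
      using summable_on_cmult_left[OF absr, of "1 / \<bar>Im z\<bar>"] by simp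
    show 2: "(\<lambda>k. norm (of_real (r k) / (z - of_real (l k)))) summable_on UNIV"
      by (rule summable_on_comparison_test[OF 1]) (use term_le[OF that] in auto)
    have "norm (S z) \<le> (\<Sum>\<^sub>\<infinity>k. norm (of_real (r k) / (z - of_real (l k))))"
      unfolding S_def by (rule norm_infsum_bound) (use 2 in simp)
    also have "\<dots> \<le> (\<Sum>\<^sub>\<infinity>k. \<bar>r k\<bar> / \<bar>Im z\<bar>)"
      by (rule infsum_mono[OF 2 1 term_le[OF that]])
    also have "\<dots> = (\<Sum>\<^sub>\<infinity>k. \<bar>r k\<bar>) / \<bar>Im z\<bar>"
      using infsum_cmult_left'[of "\<lambda>k. \<bar>r k\<bar>" "1 / \<bar>Im z\<bar>" UNIV] by simp
    finally show "norm (S z) \<le> (\<Sum>\<^sub>\<infinity>k. \<bar>r k\<bar>) / \<bar>Im z\<bar>" .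
  qed
  have S_lim: "(\<lambda>N. \<Sum>k\<in>{-int N..int N}. of_real (r k) / (z - of_real (l k))) \<longlonglongrightarrow> S z" if "Im z \<noteq> 0" for z
  proof -
    have "(\<lambda>k. of_real (r k) / (z - of_real (l k))) summable_on UNIV"
      by (rule abs_summable_summable[OF abs_summable[OF that]])
    hence "((\<lambda>k. of_real (r k) / (z - of_real (l k))) has_sum S z) UNIV" by (simp add: S_def)
    thus ?thesis unfolding has_sum_def
      by (rule filterlim_compose[OF _ filterlim_symmetric_int_intervals])
  qed
  have FS: "F z - S z = F w - S w" if "Im z \<noteq> 0" "Im w \<noteq> 0" for z w
  proof -
    have "(\<lambda>N. (\<Sum>k\<in>{-int N..int N}. of_real (r k) / (z - of_real (l k))) - (\<Sum>k\<in>{-int N..int N}. of_real (r k) / (w - of_real (l k)))) \<longlonglongrightarrow> S z - S w"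
      by (intro tendsto_diff S_lim that)
    moreover have "(\<lambda>N. (\<Sum>k\<in>{-int N..int N}. of_real (r k) / (z - of_real (l k))) - (\<Sum>k\<in>{-int N..int N}. of_real (r k) / (w - of_real (l k)))) \<longlonglongrightarrow> F z - F w"
      using diff[of z w] that npole by (simp add: right_diff_distrib sum_subtractf)
    ultimately have "S z - S w = F z - F w" by (rule LIMSEQ_unique)
    thus ?thesis by (simp add: algebra_simps)
  qed
  assume z: "Im z \<noteq> 0"
  have "((\<lambda>y::real. S (\<i> * of_real y)) \<longlongrightarrow> 0) at_top"
  proof (rule Lim_null_comparison)
    show "eventually (\<lambda>y. norm (S (\<i> * of_real y)) \<le> (\<Sum>\<^sub>\<infinity>k. \<bar>r k\<bar>) / y) at_top"
      using eventually_gt_at_top[of "0::real"]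
    proof eventually_elim
      case (elim y)
      thus ?case using Sle[of "\<i> * of_real y"] by simp
    qed
    show "((\<lambda>y. (\<Sum>\<^sub>\<infinity>k. \<bar>r k\<bar>) / y) \<longlongrightarrow> 0) at_top"
      by (rule tendsto_divide_0[OF tendsto_const]) (simp add: filterlim_ident filterlim_at_top_imp_at_infinity)
  qed
  hence "((\<lambda>y::real. F (\<i> * of_real y) - S (\<i> * of_real y)) \<longlongrightarrow> 1 - 0) at_top"
    by (intro tendsto_diff lim1)
  moreover have "eventually (\<lambda>y::real. F (\<i> * of_real y) - S (\<i> * of_real y) = F z - S z) at_top"
    using eventually_gt_at_top[of "0::real"]
  proof eventually_elim
    case (elim y)
    thus ?case using FS[of "\<i> * of_real y" z] z by simp
  qed
  ultimately have "((\<lambda>y::real. F z - S z) \<longlongrightarrow> 1 - 0) at_top"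
    by (rule Lim_transform_eventually)
  hence "F z - S z = 1" by (simp add: tendsto_const_iff)
  hence "F z = 1 + S z" by (simp add: algebra_simps)
  thus "(\<lambda>N. 1 + (\<Sum>k\<in>{-int N..int N}. of_real (r k) / (z - of_real (l k)))) \<longlonglongrightarrow> F z"
    using tendsto_add[OF tendsto_const[of 1] S_lim[OF z]] by simp
qed

section \<open>Dominated convergence of trigonometric series\<close>

text \<open>The Riesz-Fischer argument, with the majorant kept. Convergence in mean alone would not
  permit the passage to the limit inside iterated integrals; the single function \<open>D\<close>
  above all \<open>f j\<close> does. Pointwise the steps are at most sqrt (g x) q^j with q = 1 /
  sqrt 2, so norm (f 0 x) + C sqrt (g x) dominates, and it is square integrable because
  \<open>g\<close> is integrable.\<close>

lemma L2_fast_Cauchy_dominated: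
  fixes f :: "nat \<Rightarrow> 'a \<Rightarrow> 'b::{banach, second_countable_topology}"
  assumes [measurable]: "\<And>j. f j \<in> borel_measurable M"
    and f0: "(\<integral>\<^sup>+x. ennreal ((norm (f 0 x))\<^sup>2) \<partial>M) < \<infinity>"
    and step: "\<And>j. (\<integral>\<^sup>+x. ennreal ((norm (f (Suc j) x - f j x))\<^sup>2) \<partial>M) \<le> ennreal ((1/4)^j)"
  obtains D h where "h \<in> borel_measurable M" "D \<in> borel_measurable M"
    "integrable M (\<lambda>x. (D x)\<^sup>2)"
    "AE x in M. (\<forall>j. norm (f j x) \<le> D x) \<and> (\<lambda>j. f j x) \<longlonglongrightarrow> h x"
proof -
  define d where "d = (\<lambda>j x. norm (f (Suc j) x - f j x))"
  have [measurable]: "d j \<in> borel_measurable M" for j unfolding d_def by measurable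
  \<comment> \<open>The weight 2^j turns the assumed 4^(-j) into the summable 2^(-j), and it still
    forces the squared steps below 2^(-j) G pointwise.\<close>
  define G where "G = (\<lambda>x. \<Sum>j. ennreal (2^j * (d j x)\<^sup>2))"
  have [measurable]: "G \<in> borel_measurable M" unfolding G_def by measurable
  have "(\<integral>\<^sup>+x. G x \<partial>M) = (\<Sum>j. \<integral>\<^sup>+x. ennreal (2^j * (d j x)\<^sup>2) \<partial>M)"
    unfolding G_def by (intro nn_integral_suminf) measurable
  also have "\<dots> = (\<Sum>j. ennreal (2^j) * (\<integral>\<^sup>+x. ennreal ((d j x)\<^sup>2) \<partial>M))"
    by (simp add: ennreal_mult' nn_integral_cmult)
  also have "\<dots> \<le> (\<Sum>j. ennreal ((1/2)^j))"
  proof (rule suminf_le)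
    fix j :: nat
    have "ennreal (2^j) * (\<integral>\<^sup>+x. ennreal ((d j x)\<^sup>2) \<partial>M) \<le> ennreal (2^j) * ennreal ((1/4)^j)"
      unfolding d_def by (rule mult_left_mono[OF step]) simp
    also have "\<dots> = ennreal (2^j * (1/4)^j)" by (simp add: ennreal_mult')
    also have "2^j * (1/4)^j = (1/2 :: real)^j" by (simp flip: power_mult_distrib)
    finally show "ennreal (2^j) * (\<integral>\<^sup>+x. ennreal ((d j x)\<^sup>2) \<partial>M) \<le> ennreal ((1/2)^j)" .
  qed auto
  also have "\<dots> = ennreal 2"
    by (rule suminf_ennreal_eq) (use geometric_sums[of "1/2::real"] in auto)
  finally have Gfin: "(\<integral>\<^sup>+x. G x \<partial>M) \<noteq> \<infinity>" by (auto simp: top_unique)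
  define g where "g = (\<lambda>x. enn2real (G x))"
  have [measurable]: "g \<in> borel_measurable M" unfolding g_def by measurable
  have AE_G: "AE x in M. G x \<noteq> \<infinity>"
    using nn_integral_PInf_AE[OF _ Gfin] by simp
  have int_g: "integrable M g"
  proof (rule integrableI_bounded)
    have "(\<integral>\<^sup>+x. ennreal (norm (g x)) \<partial>M) \<le> (\<integral>\<^sup>+x. G x \<partial>M)"
      by (intro nn_integral_mono) (auto simp: g_def ennreal_enn2real_if)
    thus "(\<integral>\<^sup>+x. ennreal (norm (g x)) \<partial>M) < \<infinity>" using Gfin by (auto simp: less_top top_unique)
  qed measurable
  have int_f0: "integrable M (\<lambda>x. (norm (f 0 x))\<^sup>2)"
    using f0 by (intro integrableI_bounded) auto
  define q where "q = 1 / sqrt 2"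
  have q: "0 < q" "q < 1" by (auto simp: q_def)
  define C where "C = (\<Sum>j. q^j)"
  have d_le: "d j x \<le> sqrt (g x) * q^j" if "G x \<noteq> \<infinity>" for j x
  proof -
    have "ennreal (2^j * (d j x)\<^sup>2) = (\<Sum>i\<in>{j}. ennreal (2^i * (d i x)\<^sup>2))" by simp
    also have "\<dots> \<le> G x" unfolding G_def by (rule sum_le_suminf) auto
    also have "G x = ennreal (g x)" using that by (simp add: g_def less_top)
    finally have "2^j * (d j x)\<^sup>2 \<le> g x" by (subst (asm) ennreal_le_iff) (auto simp: g_def)
    hence "(d j x)\<^sup>2 \<le> g x * (1/2)^j" by (simp add: field_simps)
    hence "sqrt ((d j x)\<^sup>2) \<le> sqrt (g x * (1/2)^j)" by (rule real_sqrt_le_mono)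
    thus ?thesis by (simp add: real_sqrt_mult real_sqrt_power q_def real_sqrt_divide d_def)
  qed
  define D where "D = (\<lambda>x. norm (f 0 x) + C * sqrt (g x))"
  define h where "h = (\<lambda>x. lim (\<lambda>j. f j x))"
  have "h \<in> borel_measurable M" unfolding h_def by measurable
  moreover have "D \<in> borel_measurable M" unfolding D_def by measurable
  moreover have "integrable M (\<lambda>x. (D x)\<^sup>2)"
  proof (rule Bochner_Integration.integrable_bound)
    show "integrable M (\<lambda>x. 2 * (norm (f 0 x))\<^sup>2 + 2 * C\<^sup>2 * g x)"
      using int_f0 int_g by simp
    have "(D x)\<^sup>2 \<le> 2 * (norm (f 0 x))\<^sup>2 + 2 * C\<^sup>2 * g x" for x
    proof -
      have "(a + b)\<^sup>2 \<le> 2 * a\<^sup>2 + 2 * b\<^sup>2" for a b :: real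
        using zero_le_power2[of "a - b"] by (simp add: power2_eq_square algebra_simps)
      from this[of "norm (f 0 x)" "C * sqrt (g x)"] show ?thesis
        by (simp add: D_def power_mult_distrib g_def)
    qed
    thus "AE x in M. norm ((D x)\<^sup>2) \<le> norm (2 * (norm (f 0 x))\<^sup>2 + 2 * C\<^sup>2 * g x)"
      by (auto simp: g_def)
  qed (unfold D_def, measurable)
  moreover have "AE x in M. (\<forall>j. norm (f j x) \<le> D x) \<and> (\<lambda>j. f j x) \<longlonglongrightarrow> h x"
    using AE_G
  proof eventually_elim
    case (elim x)
    have sm: "summable (\<lambda>j. sqrt (g x) * q^j)" using q by (intro summable_mult summable_geometric) auto
    have le: "norm (f (Suc j) x - f j x) \<le> sqrt (g x) * q^j" for j using d_le[OF elim] by (simp add: d_def)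
    have tel: "f n x = f 0 x + (\<Sum>j<n. f (Suc j) x - f j x)" for n
      by (subst sum_lessThan_telescope) simp
    have "norm (f n x) \<le> D x" for n
    proof -
      have "norm (\<Sum>j<n. f (Suc j) x - f j x) \<le> (\<Sum>j<n. sqrt (g x) * q^j)"
        by (intro sum_norm_le le)
      also have "\<dots> \<le> (\<Sum>j. sqrt (g x) * q^j)" using sm q by (intro sum_le_suminf) (auto simp: g_def)
      also have "\<dots> = C * sqrt (g x)" using q by (simp add: C_def suminf_mult summable_geometric mult.commute)
      finally show ?thesis unfolding D_def by (subst tel) (rule norm_triangle_le, simp)
    qed
    moreover have "summable (\<lambda>j. f (Suc j) x - f j x)"
      by (rule summable_comparison_test'[OF sm le])
    hence "convergent (\<lambda>n. \<Sum>j<n. f (Suc j) x - f j x)" by (simp add: summable_iff_convergent)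
    hence "convergent (\<lambda>n. f 0 x + (\<Sum>j<n. f (Suc j) x - f j x))"
      by (intro convergent_add convergent_const)
    hence "convergent (\<lambda>n. f n x)" by (simp only: tel[symmetric])
    ultimately show ?case by (simp add: h_def convergent_LIMSEQ_iff)
  qed
  ultimately show ?thesis by (rule that)
qed

section \<open>Mean squares of trigonometric polynomials\<close>

lemma has_integral_exp_int:
  "((\<lambda>x. exp (\<i> * of_int k * of_real x)) has_integral (if k = 0 then 2 * of_real pi else 0 :: complex)) {0..2*pi}"
proof (cases "k = 0")
  case True
  thus ?thesis using has_integral_const_real[of "1::complex" 0 "2*pi"] by (simp add: scaleR_conv_of_real)
next
  case False
  have "((\<lambda>x. exp (\<i> * of_int k * of_real x)) has_integral
      (exp (\<i> * of_int k * of_real (2*pi)) / (\<i> * of_int k) - exp (\<i> * of_int k * of_real 0) / (\<i> * of_int k))) {0..2*pi}"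
    by (rule fundamental_theorem_of_calculus)
      (use False in \<open>auto intro!: derivative_eq_intros has_vector_derivative_real_field\<close>)
  moreover have "exp (\<i> * of_int k * of_real (2*pi)) = (1::complex)"
    using exp_two_pi_i exp_integer_2pi[of "of_int k"] by (simp add: mult_ac)
  ultimately show ?thesis using False by simp
qed

text \<open>Integer exponentials are orthogonal on {0..2*pi} but not on {0..pi}. Enlarging the
  interval only increases the integral, and the cross terms then vanish; the constant 2 pi is the
  length of the larger interval.\<close>

lemma nn_integral_trigonometric_polynomial_le:
  fixes a :: "int \<Rightarrow> real"
  assumes "finite A"
  shows "(\<integral>\<^sup>+x. ennreal ((norm (indicator {0..pi} x *\<^sub>R (\<Sum>k\<in>A. of_real (a k) * exp (\<i> * of_int k * of_real x))))\<^sup>2) \<partial>lborel)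
         \<le> ennreal (2 * pi * (\<Sum>k\<in>A. (a k)\<^sup>2))"
proof -
  define H where "H = (\<lambda>x::real. \<Sum>k\<in>A. complex_of_real (a k) * exp (\<i> * of_int k * of_real x))"
  have [measurable]: "H \<in> borel_measurable borel"
    unfolding H_def by (intro borel_measurable_continuous_onI continuous_intros)
  have H2: "complex_of_real ((norm (H x))\<^sup>2) = (\<Sum>j\<in>A. \<Sum>k\<in>A. of_real (a j * a k) * exp (\<i> * of_int (j - k) * of_real x))" for x
  proof -
    have "cnj (H x) = (\<Sum>k\<in>A. complex_of_real (a k) * exp (- (\<i> * of_int k * of_real x)))"
      by (simp add: H_def exp_cnj)
    hence "H x * cnj (H x) = (\<Sum>j\<in>A. \<Sum>k\<in>A. (of_real (a j) * exp (\<i> * of_int j * of_real x)) * (of_real (a k) * exp (- (\<i> * of_int k * of_real x))))"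
      unfolding H_def by (simp add: sum_product)
    also have "\<dots> = (\<Sum>j\<in>A. \<Sum>k\<in>A. of_real (a j * a k) * exp (\<i> * of_int (j - k) * of_real x))"
    proof (intro sum.cong refl)
      fix j k
      have "exp (\<i> * of_int j * of_real x) * exp (- (\<i> * of_int k * of_real x)) = exp (\<i> * of_int (j - k) * of_real x)"
        by (simp flip: exp_add add: algebra_simps)
      thus "(of_real (a j) * exp (\<i> * of_int j * of_real x)) * (of_real (a k) * exp (- (\<i> * of_int k * of_real x))) =
        of_real (a j * a k) * exp (\<i> * of_int (j - k) * of_real x)" by (simp add: mult_ac)
    qed
    finally show ?thesis unfolding complex_norm_square .
  qed
  have "((\<lambda>x. \<Sum>j\<in>A. \<Sum>k\<in>A. of_real (a j * a k) * exp (\<i> * of_int (j - k) * of_real x)) has_integral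
      (\<Sum>j\<in>A. \<Sum>k\<in>A. complex_of_real (a j * a k) * (if j - k = 0 then 2 * of_real pi else 0))) {0..2*pi}"
    using assms by (intro has_integral_sum has_integral_mult_right has_integral_exp_int)
  hence "((\<lambda>x. Re (complex_of_real ((norm (H x))\<^sup>2))) has_integral
      Re (\<Sum>j\<in>A. \<Sum>k\<in>A. complex_of_real (a j * a k) * (if j - k = 0 then 2 * of_real pi else 0))) {0..2*pi}"
    unfolding H2 by (rule has_integral_Re)
  moreover have "Re (\<Sum>j\<in>A. \<Sum>k\<in>A. complex_of_real (a j * a k) * (if j - k = 0 then 2 * of_real pi else 0)) = 2 * pi * (\<Sum>k\<in>A. (a k)\<^sup>2)"
    using assms by (simp add: if_distrib sum.delta sum_distrib_left power2_eq_square mult_ac cong: if_cong)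
  ultimately have "((\<lambda>x. (norm (H x))\<^sup>2) has_integral 2 * pi * (\<Sum>k\<in>A. (a k)\<^sup>2)) {0..2*pi}" by simp
  moreover have "(\<lambda>x. if x \<in> {0..2*pi} then (norm (H x))\<^sup>2 else 0) = (\<lambda>x. indicator {0..2*pi} x * (norm (H x))\<^sup>2)"
    by (auto simp: indicator_def)
  hence meas: "(\<lambda>x. if x \<in> {0..2*pi} then (norm (H x))\<^sup>2 else 0) \<in> borel_measurable borel"
    by simp
  ultimately have "((\<lambda>x. if x \<in> {0..2*pi} then (norm (H x))\<^sup>2 else 0) has_integral 2 * pi * (\<Sum>k\<in>A. (a k)\<^sup>2)) UNIV"
    by (simp only: has_integral_restrict_UNIV)
  hence "(\<integral>\<^sup>+x. ennreal (if x \<in> {0..2*pi} then (norm (H x))\<^sup>2 else 0) \<partial>lborel) = ennreal (2 * pi * (\<Sum>k\<in>A. (a k)\<^sup>2))"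
    by (intro nn_integral_has_integral_lborel meas) auto
  moreover have "(\<integral>\<^sup>+x. ennreal ((norm (indicator {0..pi} x *\<^sub>R H x))\<^sup>2) \<partial>lborel)
     \<le> (\<integral>\<^sup>+x. ennreal (if x \<in> {0..2*pi} then (norm (H x))\<^sup>2 else 0) \<partial>lborel)"
    using pi_gt_zero by (intro nn_integral_mono) (auto simp: indicator_def intro!: ennreal_leI)
  ultimately show ?thesis by (simp add: H_def)
qed

text \<open>With \<gamma> = (\<alpha> - \<beta>) / pi the frequencies are the eigenvalues l_k, and
  the value is v_1 + \<i> v_2 for the linear combination v of the eigenfunctions (cos (l_k x -
  \<alpha>), sin (l_k x - \<alpha>)) with real coefficients \<open>a k\<close>.\<close>

definition trig_poly :: "int set \<Rightarrow> (int \<Rightarrow> real) \<Rightarrow> real \<Rightarrow> real \<Rightarrow> real \<Rightarrow> complex" where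
  "trig_poly A a \<gamma> \<alpha> x = (\<Sum>k\<in>A. of_real (a k) * exp (\<i> * of_real ((of_int k + \<gamma>) * x - \<alpha>)))"

lemma trigonometric_series_L2_limit:
  fixes a :: "int \<Rightarrow> real" and \<gamma> \<alpha> :: real
  assumes a2: "(\<lambda>k. (a k)\<^sup>2) summable_on UNIV"
  defines "U \<equiv> \<lambda>N::nat. trig_poly {-int N..int N} a \<gamma> \<alpha>"
  obtains \<rho> h D where "filterlim \<rho> at_top sequentially" "h \<in> borel_measurable lborel" "D \<in> borel_measurable lborel"
    "integrable lborel (\<lambda>x. (D x)\<^sup>2)"
    "AE x in lborel. x \<in> {0..pi} \<longrightarrow> (\<forall>j. norm (U (\<rho> j) x) \<le> D x) \<and> (\<lambda>j. U (\<rho> j) x) \<longlonglongrightarrow> h x"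
proof -
  define T where "T = (\<lambda>N::nat. \<Sum>k\<in>{-int N..int N}. (a k)\<^sup>2)"
  have "((\<lambda>k. (a k)\<^sup>2) has_sum (\<Sum>\<^sub>\<infinity>k. (a k)\<^sup>2)) UNIV" using a2 by simp
  hence "T \<longlonglongrightarrow> (\<Sum>\<^sub>\<infinity>k. (a k)\<^sup>2)"
    unfolding has_sum_def T_def by (rule filterlim_compose[OF _ filterlim_symmetric_int_intervals])
  hence "Cauchy T" by (rule LIMSEQ_imp_Cauchy)
  hence "\<exists>N. \<forall>m\<ge>N. \<forall>n\<ge>N. dist (T m) (T n) < e" if "e > 0" for e
    using that by (auto simp: Cauchy_def)
  \<comment> \<open>The divisor 2 pi compensates the constant of the mean square estimate, so that
    successive differences meet the bound 4^(-j).\<close>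
  hence "\<forall>j. \<exists>N. \<forall>m\<ge>N. \<forall>n\<ge>N. dist (T m) (T n) < (1/4)^j / (2 * pi)" by simp
  then obtain \<nu> where \<nu>: "\<And>j m n. m \<ge> \<nu> j \<Longrightarrow> n \<ge> \<nu> j \<Longrightarrow> dist (T m) (T n) < (1/4)^j / (2 * pi)"
    by metis
  \<comment> \<open>Summing the \<nu> i makes \<rho> monotone and at least \<nu> j; the summand j
    makes it tend to infinity.\<close>
  define \<rho> where "\<rho> = (\<lambda>j. (\<Sum>i\<le>j. \<nu> i) + j)"
  have \<rho>_ge: "\<rho> j \<ge> \<nu> j" "\<rho> (Suc j) \<ge> \<rho> j" for j
    by (auto simp: \<rho>_def member_le_sum trans_le_add1)
  have \<rho>_lim: "filterlim \<rho> at_top sequentially"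
    by (rule filterlim_at_top_mono[OF filterlim_ident]) (auto simp: \<rho>_def)
  define H where "H = (\<lambda>A x. \<Sum>k\<in>A. complex_of_real (a k) * exp (\<i> * of_int k * of_real x))"
  define f where "f = (\<lambda>j x. indicator {0..pi} x *\<^sub>R H {-int (\<rho> j)..int (\<rho> j)} x)"
  have [measurable]: "H A \<in> borel_measurable borel" for A
    unfolding H_def by (intro borel_measurable_continuous_onI continuous_intros)
  have fm: "f j \<in> borel_measurable lborel" for j unfolding f_def by measurable
  have f0: "(\<integral>\<^sup>+x. ennreal ((norm (f 0 x))\<^sup>2) \<partial>lborel) < \<infinity>"
    unfolding f_def H_def
    by (rule order.strict_trans1[OF nn_integral_trigonometric_polynomial_le]) auto
  have step: "(\<integral>\<^sup>+x. ennreal ((norm (f (Suc j) x - f j x))\<^sup>2) \<partial>lborel) \<le> ennreal ((1/4)^j)" for j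
  proof -
    define B where "B = {-int (\<rho> (Suc j))..int (\<rho> (Suc j))} - {-int (\<rho> j)..int (\<rho> j)}"
    have sub: "{-int (\<rho> j)..int (\<rho> j)} \<subseteq> {-int (\<rho> (Suc j))..int (\<rho> (Suc j))}" using \<rho>_ge(2)[of j] by auto
    have "f (Suc j) x - f j x = indicator {0..pi} x *\<^sub>R H B x" for x
      unfolding f_def H_def B_def using sub by (simp add: sum_diff scaleR_diff_right)
    hence "(\<integral>\<^sup>+x. ennreal ((norm (f (Suc j) x - f j x))\<^sup>2) \<partial>lborel) \<le> ennreal (2 * pi * (\<Sum>k\<in>B. (a k)\<^sup>2))"
      unfolding H_def using nn_integral_trigonometric_polynomial_le[of B a] by (simp add: B_def)
    also have "(\<Sum>k\<in>B. (a k)\<^sup>2) = T (\<rho> (Suc j)) - T (\<rho> j)"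
      unfolding B_def T_def using sub by (simp add: sum_diff)
    also have "\<dots> \<le> (1/4)^j / (2 * pi)"
      using \<nu>[of j "\<rho> (Suc j)" "\<rho> j"] \<rho>_ge[of j] by (simp add: dist_real_def abs_less_iff)
    finally show ?thesis by (simp add: ennreal_leI divide_simps mult_left_mono)
  qed
  obtain D h0 where Dh: "h0 \<in> borel_measurable lborel" "D \<in> borel_measurable lborel" "integrable lborel (\<lambda>x. (D x)\<^sup>2)"
    "AE x in lborel. (\<forall>j. norm (f j x) \<le> D x) \<and> (\<lambda>j. f j x) \<longlonglongrightarrow> h0 x"
    using L2_fast_Cauchy_dominated[OF fm f0 step] by blast
  \<comment> \<open>The frequency shift \<gamma> and the phase \<alpha> sit in one common factor of
    modulus 1. Estimates and convergence can therefore be settled for integer frequencies.\<close>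
  define c where "c = (\<lambda>x. exp (\<i> * of_real (\<gamma> * x - \<alpha>)))"
  have cm: "c \<in> borel_measurable borel" unfolding c_def by (intro borel_measurable_continuous_onI continuous_intros)
  have U_eq: "U (\<rho> j) x = c x * f j x" if "x \<in> {0..pi}" for j x
  proof -
    have "c x * exp (\<i> * of_int k * of_real x) = exp (\<i> * of_real ((of_int k + \<gamma>) * x - \<alpha>))" for k
      unfolding c_def by (simp flip: exp_add add: algebra_simps)
    thus ?thesis using that by (simp add: U_def trig_poly_def f_def H_def sum_distrib_left mult.left_commute[of "c x"])
  qed
  have "(\<lambda>x. c x * h0 x) \<in> borel_measurable lborel" using cm Dh(1) by simp
  moreover have "AE x in lborel. x \<in> {0..pi} \<longrightarrow> (\<forall>j. norm (U (\<rho> j) x) \<le> D x) \<and> (\<lambda>j. U (\<rho> j) x) \<longlonglongrightarrow> c x * h0 x"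
    using Dh(4)
  proof eventually_elim
    case (elim x)
    have "norm (c x) = 1" by (simp add: c_def)
    thus ?case using elim by (auto simp: U_eq norm_mult intro!: tendsto_mult)
  qed
  ultimately show ?thesis using \<rho>_lim Dh(2,3) that by blast
qed

section \<open>Limits inside the Fourier integral and the iterated integral\<close>

lemma borel_measurable_cnj [measurable (raw)]:
  "f \<in> borel_measurable M \<Longrightarrow> (\<lambda>x. cnj (f x)) \<in> borel_measurable M"
  by (rule borel_measurable_continuous_on[of cnj]) (auto intro: continuous_intros)

lemma norm_exp_kernel_le:
  assumes "norm z \<le> B" "\<bar>s\<bar> \<le> pi"
  shows "norm (exp (- \<i> * z * of_real s)) \<le> exp (B * pi)"
proof -
  have "norm (exp (- \<i> * z * of_real s)) \<le> exp (norm (- \<i> * z * of_real s))" by (rule norm_exp)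
  also have "\<dots> = exp (norm z * \<bar>s\<bar>)" by (simp add: norm_mult)
  also have "\<dots> \<le> exp (B * pi)"
    using assms order_trans[OF norm_ge_zero assms(1)] by (simp only: exp_le_cancel_iff) (intro mult_mono, auto)
  finally show ?thesis .
qed

text \<open>Function and argument vary together, so that one statement covers both later uses: the
  limit of the partial sums at a fixed point, and the continuity in z for a fixed function.\<close>

lemma tendsto_fourier_0_pi:
  assumes fm [measurable]: "\<And>j. f j \<in> borel_measurable lborel" "g \<in> borel_measurable lborel"
    and D: "set_integrable lborel {0..pi} D"
    and AE: "AE x in lborel. x \<in> {0..pi} \<longrightarrow> (\<forall>j. norm (f j x) \<le> D x) \<and> (\<lambda>j. f j x) \<longlonglongrightarrow> g x"
    and z: "\<zeta> \<longlonglongrightarrow> z"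
  shows "(\<lambda>j. fourier_0_pi (f j) (\<zeta> j)) \<longlonglongrightarrow> fourier_0_pi g z"
proof -
  obtain B where B: "\<And>j. norm (\<zeta> j) \<le> B"
    using convergent_imp_Bseq[OF convergentI[OF z]] by (auto simp: Bseq_def)
  have Di: "integrable lborel (\<lambda>x. indicator {0..pi} x * D x)" using D by (simp add: set_integrable_def)
  show ?thesis unfolding fourier_0_pi_def set_lebesgue_integral_def
  proof (rule integral_dominated_convergence)
    show "integrable lborel (\<lambda>x. exp (B * pi) * (indicator {0..pi} x * D x))" using Di by simp
    show "AE x in lborel. (\<lambda>j. indicat_real {0..pi} x *\<^sub>R (exp (- \<i> * \<zeta> j * of_real x) * f j x))
        \<longlonglongrightarrow> indicat_real {0..pi} x *\<^sub>R (exp (- \<i> * z * of_real x) * g x)"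
      using AE by eventually_elim (auto simp: indicator_def intro!: tendsto_intros z)
    show "AE x in lborel. norm (indicat_real {0..pi} x *\<^sub>R (exp (- \<i> * \<zeta> j * of_real x) * f j x))
        \<le> exp (B * pi) * (indicator {0..pi} x * D x)" for j
      using AE
    proof eventually_elim
      case (elim x)
      show ?case
      proof (cases "x \<in> {0..pi}")
        case True
        hence "norm (exp (- \<i> * \<zeta> j * of_real x)) * norm (f j x) \<le> exp (B * pi) * D x"
          using norm_exp_kernel_le[OF B, of x j] elim by (intro mult_mono) auto
        thus ?thesis using True by (simp add: norm_mult)
      qed auto
    qed
  qed measurable
qed

text \<open>Dominated convergence is applied twice. The inner integrals converge for every x in
  {0..pi} and are bounded by the integral of \<open>b\<close> uniformly in j and x, so a constant
  multiple of \<open>D\<close> dominates the outer integrands.\<close>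

lemma tendsto_Phi_fun:
  assumes fm [measurable]: "\<And>j. f j \<in> borel_measurable lborel" "g \<in> borel_measurable lborel"
    and D: "set_integrable lborel {0..pi} D"
    and AE: "AE x in lborel. x \<in> {0..pi} \<longrightarrow> (\<forall>j. norm (f j x) \<le> D x) \<and> (\<lambda>j. f j x) \<longlonglongrightarrow> g x"
    and z: "\<zeta> \<longlonglongrightarrow> z"
  shows "(\<lambda>j. Phi_fun (f j) (\<zeta> j)) \<longlonglongrightarrow> Phi_fun g z"
proof -
  obtain B where B: "\<And>j. norm (\<zeta> j) \<le> B"
    using convergent_imp_Bseq[OF convergentI[OF z]] by (auto simp: Bseq_def)
  have Di: "integrable lborel (\<lambda>x. indicator {0..pi} x * D x)" using D by (simp add: set_integrable_def)
  define I where "I = (\<lambda>w h x. LBINT t:{0..x}. exp (- \<i> * w * of_real (x - t)) * cnj (h t))"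
  define b where "b = (\<lambda>t. exp (B * pi) * (indicator {0..pi} t * D t))"
  have bi: "integrable lborel b" using Di by (simp add: b_def)
  \<comment> \<open>The domain of the inner integral depends on x. Writing it as the condition 0 <=
    t <= x makes the integrand jointly measurable, and measurability of a parameter integral
    applies.\<close>
  have I_meas [measurable]: "I w h \<in> borel_measurable lborel" if [measurable]: "h \<in> borel_measurable lborel" for w h
  proof -
    have "(\<lambda>(x, t). if 0 \<le> t \<and> t \<le> x then exp (- \<i> * w * of_real (x - t)) * cnj (h t) else 0)
        \<in> borel_measurable (borel \<Otimes>\<^sub>M borel)" by measurable
    hence *: "(\<lambda>(x, t). if 0 \<le> t \<and> t \<le> x then exp (- \<i> * w * of_real (x - t)) * cnj (h t) else 0)
        \<in> borel_measurable (lborel \<Otimes>\<^sub>M lborel)"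
      by (simp cong: measurable_cong_sets sets_pair_measure_cong)
    have "I w h = (\<lambda>x. \<integral>t. (if 0 \<le> t \<and> t \<le> x then exp (- \<i> * w * of_real (x - t)) * cnj (h t) else 0) \<partial>lborel)"
      unfolding I_def set_lebesgue_integral_def by (intro ext Bochner_Integration.integral_cong) (auto simp: indicator_def)
    also have "\<dots> \<in> borel_measurable lborel"
      using * by (rule lborel.borel_measurable_lebesgue_integral)
    finally show ?thesis .
  qed
  have AE_b: "AE t in lborel. norm (indicat_real {0..x} t *\<^sub>R (exp (- \<i> * \<zeta> j * of_real (x - t)) * cnj (f j t))) \<le> b t"
    if x: "x \<in> {0..pi}" for x j
    using AE
  proof eventually_elim
    case (elim t)
    show ?case
    proof (cases "t \<in> {0..x}")
      case True
      hence "norm (exp (- \<i> * \<zeta> j * of_real (x - t))) * norm (f j t) \<le> exp (B * pi) * D t"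
        using x norm_exp_kernel_le[OF B, of "x - t" j] elim by (intro mult_mono) auto
      thus ?thesis using True x by (simp add: norm_mult b_def)
    next
      case False
      have "0 \<le> indicator {0..pi} t * D t"
        using elim order_trans[OF norm_ge_zero] by (auto simp: indicator_def)
      thus ?thesis using False by (simp add: b_def)
    qed
  qed
  have I_lim: "(\<lambda>j. I (\<zeta> j) (f j) x) \<longlonglongrightarrow> I z g x" if x: "x \<in> {0..pi}" for x
    unfolding I_def set_lebesgue_integral_def
  proof (rule integral_dominated_convergence[OF _ _ bi _ AE_b[OF x]])
    show "AE t in lborel. (\<lambda>j. indicat_real {0..x} t *\<^sub>R (exp (- \<i> * \<zeta> j * of_real (x - t)) * cnj (f j t)))
        \<longlonglongrightarrow> indicat_real {0..x} t *\<^sub>R (exp (- \<i> * z * of_real (x - t)) * cnj (g t))"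
      using AE by eventually_elim (use x in \<open>auto simp: indicator_def intro!: tendsto_intros z\<close>)
  qed measurable
  have I_bd: "norm (I (\<zeta> j) (f j) x) \<le> (\<integral>t. b t \<partial>lborel)" if x: "x \<in> {0..pi}" for x j
    unfolding I_def set_lebesgue_integral_def
    by (rule order_trans[OF integral_norm_bound])
       (intro integral_mono_AE bi AE_b[OF x] integrable_norm Bochner_Integration.integrable_bound[OF bi], measurable,
        use AE_b[OF x, of j] in \<open>auto elim!: eventually_mono\<close>)
  have "(\<lambda>j. LBINT x:{0..pi}. I (\<zeta> j) (f j) x * f j x) \<longlonglongrightarrow> (LBINT x:{0..pi}. I z g x * g x)"
    unfolding set_lebesgue_integral_def
  proof (rule integral_dominated_convergence)
    show "integrable lborel (\<lambda>x. (\<integral>t. b t \<partial>lborel) * (indicator {0..pi} x * D x))" using Di by simp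
    show "AE x in lborel. (\<lambda>j. indicat_real {0..pi} x *\<^sub>R (I (\<zeta> j) (f j) x * f j x))
        \<longlonglongrightarrow> indicat_real {0..pi} x *\<^sub>R (I z g x * g x)"
      using AE by eventually_elim (auto simp: indicator_def intro!: tendsto_intros I_lim)
    show "AE x in lborel. norm (indicat_real {0..pi} x *\<^sub>R (I (\<zeta> j) (f j) x * f j x))
        \<le> (\<integral>t. b t \<partial>lborel) * (indicator {0..pi} x * D x)" for j
      using AE
    proof eventually_elim
      case (elim x)
      show ?case
      proof (cases "x \<in> {0..pi}")
        case True
        hence "norm (I (\<zeta> j) (f j) x) * norm (f j x) \<le> (\<integral>t. b t \<partial>lborel) * D x"
          using I_bd[OF True, of j] elim order_trans[OF norm_ge_zero I_bd[OF True, of j]] by (intro mult_mono) auto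
        thus ?thesis using True by (simp add: norm_mult)
      qed auto
    qed
  qed measurable
  thus ?thesis by (simp add: Phi_fun_def I_def)
qed

section \<open>The characteristic function of a trigonometric polynomial\<close>

lemma has_bochner_integral_exp_Icc:
  fixes c :: complex
  assumes "b \<ge> 0"
  shows "has_bochner_integral lborel (\<lambda>x. indicator {0..b} x *\<^sub>R exp (c * of_real x))
           (if c = 0 then of_real b else (exp (c * of_real b) - 1) / c)"
proof (cases "c = 0")
  case True
  have "has_bochner_integral lborel (\<lambda>x. indicator {0..b} x *\<^sub>R (1::complex)) (of_real b - of_real 0)"
    by (rule has_bochner_integral_FTC_Icc[OF assms])
      (auto intro!: derivative_eq_intros simp: has_real_derivative_iff_has_vector_derivative)
  thus ?thesis using True by simp
next
  case False
  have "has_bochner_integral lborel (\<lambda>x. indicator {0..b} x *\<^sub>R exp (c * of_real x))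
      (exp (c * of_real b) / c - exp (c * of_real 0) / c)"
    by (rule has_bochner_integral_FTC_Icc[OF assms])
      (use False in \<open>auto intro!: derivative_eq_intros has_vector_derivative_real_field continuous_intros\<close>)
  thus ?thesis using False by (simp add: diff_divide_distrib)
qed

lemma mult_scaleR_rearrange:
  fixes u v w c b :: "'a :: {comm_ring_1, real_algebra}"
  assumes "u * v = w * c"
  shows "(u * b) * (s *\<^sub>R v) = s *\<^sub>R (w * (b * c))"
proof -
  have "(u * b) * (s *\<^sub>R v) = s *\<^sub>R (b * (u * v))" by (simp add: mult_ac)
  also have "b * (u * v) = w * (b * c)" unfolding assms by (simp add: mult_ac)
  finally show ?thesis .
qed

text \<open>Here \<open>p k\<close> is the exponent left when exp (- \<i> z x) meets the frequency
  l_k. Its zeros are the eigenvalues, which are kept apart so that the quotients are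
  genuine.\<close>

lemma fourier_0_pi_trig_poly:
  fixes z :: complex and \<gamma> :: real
  assumes "finite A"
  defines "p \<equiv> \<lambda>k::int. \<i> * (of_real (of_int k + \<gamma>) - z)"
  assumes p0: "\<And>k. k \<in> A \<Longrightarrow> p k \<noteq> 0"
  shows "fourier_0_pi (trig_poly A a \<gamma> \<alpha>) z =
           exp (- \<i> * of_real \<alpha>) * (\<Sum>k\<in>A. of_real (a k) * ((exp (p k * of_real pi) - 1) / p k))"
proof -
  have "has_bochner_integral lborel
     (\<lambda>x. \<Sum>k\<in>A. (exp (- \<i> * of_real \<alpha>) * of_real (a k)) * (indicator {0..pi} x *\<^sub>R exp (p k * of_real x)))
     (\<Sum>k\<in>A. (exp (- \<i> * of_real \<alpha>) * of_real (a k)) * (if p k = 0 then of_real pi else (exp (p k * of_real pi) - 1) / p k))"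
    by (intro has_bochner_integral_sum has_bochner_integral_mult_right has_bochner_integral_exp_Icc) auto
  moreover have "(\<Sum>k\<in>A. (exp (- \<i> * of_real \<alpha>) * of_real (a k)) * (indicator {0..pi} x *\<^sub>R exp (p k * of_real x)))
     = indicator {0..pi} x *\<^sub>R (exp (- \<i> * z * of_real x) * trig_poly A a \<gamma> \<alpha> x)" for x
  proof -
    have "exp (- \<i> * of_real \<alpha>) * exp (p k * of_real x) = exp (- \<i> * z * of_real x) * exp (\<i> * of_real ((of_int k + \<gamma>) * x - \<alpha>))" for k
      by (simp flip: exp_add add: p_def algebra_simps)
    thus ?thesis unfolding trig_poly_def sum_distrib_left scaleR_sum_right
      by (intro sum.cong refl mult_scaleR_rearrange)
  qed
  ultimately have "fourier_0_pi (trig_poly A a \<gamma> \<alpha>) z =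
     (\<Sum>k\<in>A. (exp (- \<i> * of_real \<alpha>) * of_real (a k)) * (if p k = 0 then of_real pi else (exp (p k * of_real pi) - 1) / p k))"
    unfolding fourier_0_pi_def set_lebesgue_integral_def by (simp add: has_bochner_integral_integral_eq)
  also have "\<dots> = exp (- \<i> * of_real \<alpha>) * (\<Sum>k\<in>A. of_real (a k) * ((exp (p k * of_real pi) - 1) / p k))"
    unfolding sum_distrib_left by (intro sum.cong) (use p0 in \<open>auto simp: mult.assoc\<close>)
  finally show ?thesis .
qed

text \<open>The inner integral brings 1 / p_k times a difference of two exponentials, and the outer
  one integrates exp (p_j x) and exp ((p_j - p_k) x). The second exponent does not contain z and
  vanishes for j = k; this diagonal value pi is the source of the partial fractions in the
  characteristic function.\<close>

lemma Phi_fun_trig_poly: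
  fixes z :: complex and \<gamma> :: real
  assumes A: "finite A"
  defines "p \<equiv> \<lambda>k::int. \<i> * (of_real (of_int k + \<gamma>) - z)"
  assumes p0: "\<And>k. k \<in> A \<Longrightarrow> p k \<noteq> 0"
  shows "Phi_fun (trig_poly A a \<gamma> \<alpha>) z =
           (\<Sum>j\<in>A. \<Sum>k\<in>A. of_real (a j * a k) * (((exp (p j * of_real pi) - 1) / p j -
              (if p j - p k = 0 then of_real pi else (exp ((p j - p k) * of_real pi) - 1) / (p j - p k))) / p k))"
proof -
  define u where "u = trig_poly A a \<gamma> \<alpha>"
  define e where "e = exp (\<i> * of_real \<alpha>)"
  have inner: "(LBINT t:{0..x}. exp (- \<i> * z * of_real (x - t)) * cnj (u t)) =
      (\<Sum>k\<in>A. e * of_real (a k) * exp (- \<i> * z * of_real x) * ((1 - exp (- p k * of_real x)) / p k))" if "x \<ge> 0" for x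
  proof -
    have "has_bochner_integral lborel
     (\<lambda>t. \<Sum>k\<in>A. ((e * exp (- \<i> * z * of_real x)) * of_real (a k)) * (indicator {0..x} t *\<^sub>R exp (- p k * of_real t)))
     (\<Sum>k\<in>A. ((e * exp (- \<i> * z * of_real x)) * of_real (a k)) * (if - p k = 0 then of_real x else (exp (- p k * of_real x) - 1) / (- p k)))"
      by (intro has_bochner_integral_sum has_bochner_integral_mult_right has_bochner_integral_exp_Icc that)
    moreover have "(\<Sum>k\<in>A. ((e * exp (- \<i> * z * of_real x)) * of_real (a k)) * (indicator {0..x} t *\<^sub>R exp (- p k * of_real t)))
       = indicator {0..x} t *\<^sub>R (exp (- \<i> * z * of_real (x - t)) * cnj (u t))" for t
    proof -
      have "e * exp (- \<i> * z * of_real x) * exp (- p k * of_real t) =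
          exp (- \<i> * z * of_real (x - t)) * cnj (exp (\<i> * of_real ((of_int k + \<gamma>) * t - \<alpha>)))" for k
        unfolding e_def exp_cnj by (simp flip: exp_add add: p_def algebra_simps)
      thus ?thesis unfolding u_def trig_poly_def cnj_sum complex_cnj_mult complex_cnj_complex_of_real sum_distrib_left scaleR_sum_right
        by (intro sum.cong refl mult_scaleR_rearrange)
    qed
    ultimately have "(LBINT t:{0..x}. exp (- \<i> * z * of_real (x - t)) * cnj (u t)) =
       (\<Sum>k\<in>A. ((e * exp (- \<i> * z * of_real x)) * of_real (a k)) * (if - p k = 0 then of_real x else (exp (- p k * of_real x) - 1) / (- p k)))"
      unfolding set_lebesgue_integral_def by (simp only: has_bochner_integral_integral_eq)
    also have "\<dots> = (\<Sum>k\<in>A. e * of_real (a k) * exp (- \<i> * z * of_real x) * ((1 - exp (- p k * of_real x)) / p k))"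
    proof (intro sum.cong refl)
      fix k assume "k \<in> A"
      hence "p k \<noteq> 0" by (rule p0)
      hence "(exp (- p k * of_real x) - 1) / (- p k) = (1 - exp (- p k * of_real x)) / p k" by (simp add: field_simps)
      thus "((e * exp (- \<i> * z * of_real x)) * of_real (a k)) * (if - p k = 0 then of_real x else (exp (- p k * of_real x) - 1) / (- p k))
          = e * of_real (a k) * exp (- \<i> * z * of_real x) * ((1 - exp (- p k * of_real x)) / p k)"
        using \<open>p k \<noteq> 0\<close> by (simp add: mult_ac)
    qed
    finally show ?thesis .
  qed
  have "has_bochner_integral lborel
     (\<lambda>x. \<Sum>j\<in>A. \<Sum>k\<in>A. of_real (a j * a k) / p k * (indicator {0..pi} x *\<^sub>R exp (p j * of_real x) -
             indicator {0..pi} x *\<^sub>R exp ((p j - p k) * of_real x)))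
     (\<Sum>j\<in>A. \<Sum>k\<in>A. of_real (a j * a k) / p k * ((if p j = 0 then of_real pi else (exp (p j * of_real pi) - 1) / p j) -
              (if p j - p k = 0 then of_real pi else (exp ((p j - p k) * of_real pi) - 1) / (p j - p k))))"
    by (intro has_bochner_integral_sum has_bochner_integral_mult_right has_bochner_integral_diff has_bochner_integral_exp_Icc) auto
  moreover have "(\<Sum>j\<in>A. \<Sum>k\<in>A. of_real (a j * a k) / p k * (indicator {0..pi} x *\<^sub>R exp (p j * of_real x) -
             indicator {0..pi} x *\<^sub>R exp ((p j - p k) * of_real x))) =
      indicator {0..pi} x *\<^sub>R ((LBINT t:{0..x}. exp (- \<i> * z * of_real (x - t)) * cnj (u t)) * u x)" for x
  proof (cases "x \<in> {0..pi}")
    case True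
    have "(LBINT t:{0..x}. exp (- \<i> * z * of_real (x - t)) * cnj (u t)) * u x =
       (\<Sum>j\<in>A. \<Sum>k\<in>A. of_real (a j * a k) / p k * (exp (p j * of_real x) - exp ((p j - p k) * of_real x)))"
    proof -
      have rearr: "(e * c * X * ((1 - Q) / q)) * (b * Y) = b * c / q * (e * X * Y - e * X * Y * Q)" for e c X Q q b Y :: complex
        by (simp add: algebra_simps diff_divide_distrib)
      have "e * exp (- \<i> * z * of_real x) * exp (\<i> * of_real ((of_int j + \<gamma>) * x - \<alpha>)) = exp (p j * of_real x)" for j
        unfolding e_def by (simp flip: exp_add add: p_def algebra_simps)
      moreover have "exp (p j * of_real x) * exp (- p k * of_real x) = exp ((p j - p k) * of_real x)" for j k
        by (simp flip: exp_add add: algebra_simps)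
      ultimately have "(e * of_real (a k) * exp (- \<i> * z * of_real x) * ((1 - exp (- p k * of_real x)) / p k)) * 
          (of_real (a j) * exp (\<i> * of_real ((of_int j + \<gamma>) * x - \<alpha>))) =
          of_real (a j * a k) / p k * (exp (p j * of_real x) - exp ((p j - p k) * of_real x))" for j k
        using rearr[of e "of_real (a k)" "exp (- \<i> * z * of_real x)" "exp (- p k * of_real x)" "p k" "of_real (a j)"
            "exp (\<i> * of_real ((of_int j + \<gamma>) * x - \<alpha>))"] by (simp only: of_real_mult)
      note summand = this
      have ux: "u x = (\<Sum>j\<in>A. of_real (a j) * exp (\<i> * of_real ((of_int j + \<gamma>) * x - \<alpha>)))"
        by (simp only: u_def trig_poly_def)
      have x0: "0 \<le> x" using True by simp
      show ?thesis unfolding inner[OF x0] ux sum_product summand by (rule sum.swap)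
    qed
    thus ?thesis using True by simp
  qed simp
  ultimately have "Phi_fun u z = (\<Sum>j\<in>A. \<Sum>k\<in>A. of_real (a j * a k) / p k * ((if p j = 0 then of_real pi else (exp (p j * of_real pi) - 1) / p j) -
              (if p j - p k = 0 then of_real pi else (exp ((p j - p k) * of_real pi) - 1) / (p j - p k))))"
    unfolding Phi_fun_def set_lebesgue_integral_def by (simp only: has_bochner_integral_integral_eq)
  also have "\<dots> = (\<Sum>j\<in>A. \<Sum>k\<in>A. of_real (a j * a k) * (((exp (p j * of_real pi) - 1) / p j -
              (if p j - p k = 0 then of_real pi else (exp ((p j - p k) * of_real pi) - 1) / (p j - p k))) / p k))"
    by (intro sum.cong refl) (use p0 in \<open>simp del: of_real_mult\<close>)
  finally show ?thesis unfolding u_def .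
qed

text \<open>Only vectors \<open>v\<close> with real entries are needed. For these \<open>v_minus v\<close> is the conjugate of
  \<open>u = v_plus v\<close>, and the two terms \<open>\<Phi>\<close> in \<open>R\<close> coincide.\<close>
definition real_vec :: "(real \<Rightarrow> complex) \<Rightarrow> real \<Rightarrow> complex ^ 2" where
  "real_vec u x = vector [of_real (Re (u x)), of_real (Im (u x))]"

lemma v_plus_real_vec [simp]: "v_plus (real_vec u) = u"
  by (rule ext) (simp add: v_plus_def real_vec_def complex_eq_iff)

lemma v_minus_real_vec [simp]: "v_minus (real_vec u) = (\<lambda>x. cnj (u x))"
  by (rule ext) (simp add: v_minus_def real_vec_def complex_eq_iff)

lemma norm_real_vec [simp]: "norm (real_vec u x) = norm (u x)"
  by (simp add: norm_vec_def L2_set_def sum_2 real_vec_def cmod_def)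

lemma conj_fun_fourier_0_pi_cnj: "conj_fun (fourier_0_pi (\<lambda>x. cnj (u x))) (- z) = fourier_0_pi u z"
  unfolding conj_fun_def fourier_0_pi_def set_lebesgue_integral_def
  by (subst Bochner_Integration.integral_cnj [symmetric]) (simp add: exp_cnj scaleR_conv_of_real)

lemma conj_fun_Phi_fun_cnj: "conj_fun (Phi_fun (\<lambda>x. cnj (u x))) (- z) = Phi_fun u z"
proof -
  have "cnj (LBINT t:{0..x}. exp (- \<i> * cnj (- z) * of_real (x - t)) * cnj (cnj (u t)))
      = (LBINT t:{0..x}. exp (- \<i> * z * of_real (x - t)) * cnj (u t))" for x
    unfolding set_lebesgue_integral_def
    by (subst Bochner_Integration.integral_cnj [symmetric]) (simp add: exp_cnj scaleR_conv_of_real)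
  moreover have "conj_fun (Phi_fun (\<lambda>x. cnj (u x))) (- z) =
     (LBINT x:{0..pi}. cnj (LBINT t:{0..x}. exp (- \<i> * cnj (- z) * of_real (x - t)) * cnj (cnj (u t))) * u x)"
    unfolding conj_fun_def Phi_fun_def set_lebesgue_integral_def[of _ "{0..pi}"]
    by (subst Bochner_Integration.integral_cnj [symmetric]) (simp add: scaleR_conv_of_real)
  ultimately show ?thesis by (simp only: Phi_fun_def)
qed

lemma R_fun_real_vec:
  "R_fun \<alpha> (real_vec u) z = 2 * Phi_fun u z + (exp (\<i> * of_real \<alpha>) * fourier_0_pi u z)\<^sup>2"
proof -
  have "exp (2 * \<i> * of_real \<alpha>) = (exp (\<i> * of_real \<alpha>))\<^sup>2"
    using exp_double[of "\<i> * of_real \<alpha>"] by (simp only: mult.assoc)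
  thus ?thesis
    by (simp add: R_fun_def conj_fun_fourier_0_pi_cnj conj_fun_Phi_fun_cnj power_mult_distrib power2_eq_square[of "fourier_0_pi _ _"])
qed

text \<open>The coefficient of a_j a_k in R: two terms from the ordered pairs (j, k) and (k, j) in
  twice Phi, and the product from the squared Fourier integral. With the signs e, f of the
  exponentials over the common denominator p q, everything cancels except e f (w^2 - 1). The
  coefficient thus factors into a part for j and a part for k, and the double sum becomes a perfect
  square.\<close>

lemma symmetrised_kernel_identity:
  fixes p q :: complex
  assumes "p \<noteq> 0" "q \<noteq> 0" "p \<noteq> q" "e * e = 1" "f * f = 1"
  shows "((e * w - 1) / p - (e * f - 1) / (p - q)) / q + ((f * w - 1) / q - (f * e - 1) / (q - p)) / p
            + ((e * w - 1) / p) * ((f * w - 1) / q) = (w\<^sup>2 - 1) * (e / p * (f / q))"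
proof -
  have "(f * e - 1) / (q - p) = - ((e * f - 1) / (p - q))"
    using assms(3) by (simp add: divide_simps) (simp add: algebra_simps)
  moreover have "(e * f - 1) / (p - q) / p - (e * f - 1) / (p - q) / q = - ((e * f - 1) / (p * q))"
    using assms(1-3) by (simp add: divide_simps) (simp add: algebra_simps)
  ultimately have "((e * w - 1) / p - (e * f - 1) / (p - q)) / q + ((f * w - 1) / q - (f * e - 1) / (q - p)) / p
      = ((e * w - 1) + (f * w - 1) - (e * f - 1)) / (p * q)"
    using assms(1,2) by (simp add: diff_divide_distrib add_divide_distrib) (simp add: algebra_simps)
  also have "\<dots> + ((e * w - 1) / p) * ((f * w - 1) / q) = (w\<^sup>2 - 1) * (e / p * (f / q))"
    using assms(1,2) by (simp add: divide_simps) (simp add: algebra_simps power2_eq_square)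
  finally show ?thesis .
qed

text \<open>The case j = k, with c in place of the diagonal integral pi. Only -2 c / p escapes the
  perfect square.\<close>

lemma symmetrised_kernel_identity_diagonal:
  fixes p :: complex
  assumes "p \<noteq> 0" "e * e = 1"
  shows "((e * w - 1) / p - c) / p + ((e * w - 1) / p - c) / p + ((e * w - 1) / p) * ((e * w - 1) / p)
       = (w\<^sup>2 - 1) * (e / p * (e / p)) - 2 * c / p"
proof -
  have 1: "(X - c) / p + (X - c) / p + X * X = (X * X + 2 * X / p) - 2 * c / p" for X
    by (simp add: diff_divide_distrib)
  have 2: "(e * w - 1) / p * ((e * w - 1) / p) + 2 * ((e * w - 1) / p) / p = (e * e * (w * w) - 1) / (p * p)"
    using assms(1) by (simp add: divide_simps) (simp add: algebra_simps)
  have 3: "(w\<^sup>2 - 1) * (e / p * (e / p)) = (w * w - 1) * (e * e) / (p * p)"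
    by (simp add: power2_eq_square)
  show ?thesis unfolding 1 2 3 assms(2) by simp
qed

text \<open>Separates the sign, which depends on k alone, from a phase common to all k.\<close>

lemma exp_pi_int_shift:
  "exp (\<i> * (of_real (of_int k + \<gamma>) - z) * of_real pi) =
     of_real (cos (pi * of_int k)) * exp (\<i> * of_real pi * (of_real \<gamma> - z))"
proof -
  have "exp (\<i> * of_real (pi * of_int k)) = of_real (cos (pi * of_int k))"
    by (simp only: cis_conv_exp[symmetric]) (simp add: complex_eq_iff sin_npi_int)
  moreover have "\<i> * (of_real (of_int k + \<gamma>) - z) * of_real pi = \<i> * of_real (pi * of_int k) + \<i> * of_real pi * (of_real \<gamma> - z)"
    by (simp add: algebra_simps)
  ultimately show ?thesis by (simp only: exp_add)
qed

lemma R_fun_trig_poly: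
  fixes z :: complex and \<gamma> :: real
  assumes A: "finite A"
  defines "p \<equiv> \<lambda>k::int. \<i> * (of_real (of_int k + \<gamma>) - z)"
  defines "\<epsilon> \<equiv> \<lambda>k::int. complex_of_real (cos (pi * of_int k))"
  defines "w \<equiv> exp (\<i> * of_real pi * (of_real \<gamma> - z))"
  assumes p0: "\<And>k. k \<in> A \<Longrightarrow> p k \<noteq> 0"
  shows "R_fun \<alpha> (real_vec (trig_poly A a \<gamma> \<alpha>)) z =
     (w\<^sup>2 - 1) * (\<Sum>k\<in>A. of_real (a k) * (\<epsilon> k / p k))\<^sup>2 - 2 * of_real pi * (\<Sum>k\<in>A. of_real ((a k)\<^sup>2) / p k)"
proof -
  define E where "E = (\<lambda>k. (\<epsilon> k * w - 1) / p k)"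
  define \<delta> where "\<delta> = (\<lambda>j k. if j = k then of_real pi else (\<epsilon> j * \<epsilon> k - 1) / (p j - p k))"
  have ee: "\<epsilon> k * \<epsilon> k = 1" for k by (simp add: \<epsilon>_def)
  have w0: "w \<noteq> 0" by (simp add: w_def)
  have exp_p: "exp (p k * of_real pi) = \<epsilon> k * w" for k
    unfolding p_def \<epsilon>_def w_def by (rule exp_pi_int_shift)
  have exp_pp: "exp ((p j - p k) * of_real pi) = \<epsilon> j * \<epsilon> k" for j k
  proof -
    have "exp ((p j - p k) * of_real pi) = (\<epsilon> j * w) / (\<epsilon> k * w)"
      by (simp add: left_diff_distrib exp_diff exp_p)
    also have "\<dots> = \<epsilon> j * \<epsilon> k" using w0 ee[of k] by (simp add: divide_simps)
    finally show ?thesis .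
  qed
  have p_inj: "p j - p k = 0 \<longleftrightarrow> j = k" for j k by (auto simp: p_def)
  have four: "exp (\<i> * of_real \<alpha>) * fourier_0_pi (trig_poly A a \<gamma> \<alpha>) z = (\<Sum>k\<in>A. of_real (a k) * E k)"
  proof -
    have "fourier_0_pi (trig_poly A a \<gamma> \<alpha>) z =
           exp (- \<i> * of_real \<alpha>) * (\<Sum>k\<in>A. of_real (a k) * ((exp (p k * of_real pi) - 1) / p k))"
      unfolding p_def by (rule fourier_0_pi_trig_poly[OF A p0[unfolded p_def]])
    moreover have "exp (\<i> * of_real \<alpha>) * exp (- \<i> * of_real \<alpha>) = 1" by (simp flip: exp_add)
    ultimately show ?thesis unfolding exp_p E_def by (simp flip: mult.assoc)
  qed
  have Phi: "Phi_fun (trig_poly A a \<gamma> \<alpha>) z = (\<Sum>j\<in>A. \<Sum>k\<in>A. of_real (a j * a k) * ((E j - \<delta> j k) / p k))"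
  proof -
    have "Phi_fun (trig_poly A a \<gamma> \<alpha>) z =
           (\<Sum>j\<in>A. \<Sum>k\<in>A. of_real (a j * a k) * (((exp (p j * of_real pi) - 1) / p j -
              (if p j - p k = 0 then of_real pi else (exp ((p j - p k) * of_real pi) - 1) / (p j - p k))) / p k))"
      unfolding p_def by (rule Phi_fun_trig_poly[OF A p0[unfolded p_def]])
    thus ?thesis unfolding exp_pp exp_p p_inj E_def \<delta>_def .
  qed
  \<comment> \<open>The factor 2 is used to add the double sum to its transpose, so that each
    summand takes the form of the symmetrised kernel.\<close>
  have "2 * Phi_fun (trig_poly A a \<gamma> \<alpha>) z =
     (\<Sum>j\<in>A. \<Sum>k\<in>A. of_real (a j * a k) * ((E j - \<delta> j k) / p k)) + (\<Sum>j\<in>A. \<Sum>k\<in>A. of_real (a k * a j) * ((E k - \<delta> k j) / p j))"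
    unfolding Phi using sum.swap[of "\<lambda>j k. of_real (a j * a k) * ((E j - \<delta> j k) / p k)" A A] by simp
  hence "R_fun \<alpha> (real_vec (trig_poly A a \<gamma> \<alpha>)) z =
      (\<Sum>j\<in>A. \<Sum>k\<in>A. of_real (a j * a k) * ((E j - \<delta> j k) / p k)
         + of_real (a k * a j) * ((E k - \<delta> k j) / p j) + (of_real (a j) * E j) * (of_real (a k) * E k))"
    unfolding R_fun_real_vec four by (simp only: power2_eq_square sum_product sum.distrib)
  also have "\<dots> = (\<Sum>j\<in>A. \<Sum>k\<in>A. (w\<^sup>2 - 1) * ((of_real (a j) * (\<epsilon> j / p j)) * (of_real (a k) * (\<epsilon> k / p k)))
         - (if j = k then 2 * of_real pi * (of_real ((a j)\<^sup>2) / p j) else 0))"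
  proof (intro sum.cong refl)
    fix j k assume jk: "j \<in> A" "k \<in> A"
    have "of_real (a j * a k) * ((E j - \<delta> j k) / p k)
         + of_real (a k * a j) * ((E k - \<delta> k j) / p j) + (of_real (a j) * E j) * (of_real (a k) * E k) =
         of_real (a j * a k) * ((E j - \<delta> j k) / p k + (E k - \<delta> k j) / p j + E j * E k)"
      by (simp add: algebra_simps)
    also have "(E j - \<delta> j k) / p k + (E k - \<delta> k j) / p j + E j * E k =
        (w\<^sup>2 - 1) * (\<epsilon> j / p j * (\<epsilon> k / p k)) - (if j = k then 2 * of_real pi / p j else 0)"
    proof (cases "j = k")
      case True
      thus ?thesis unfolding E_def \<delta>_def
        using symmetrised_kernel_identity_diagonal[OF p0[OF jk(1)] ee[of j], of w "of_real pi"] by simp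
    next
      case False
      hence "p j \<noteq> p k" using p_inj[of j k] by simp
      thus ?thesis unfolding E_def \<delta>_def
        using False symmetrised_kernel_identity[OF p0[OF jk(1)] p0[OF jk(2)] _ ee[of j] ee[of k], of w] by simp
    qed
    also have "of_real (a j * a k) * \<dots> = (w\<^sup>2 - 1) * ((of_real (a j) * (\<epsilon> j / p j)) * (of_real (a k) * (\<epsilon> k / p k)))
         - (if j = k then 2 * of_real pi * (of_real ((a j)\<^sup>2) / p j) else 0)"
      by (simp add: right_diff_distrib power2_eq_square mult_ac)
    finally show "of_real (a j * a k) * ((E j - \<delta> j k) / p k)
         + of_real (a k * a j) * ((E k - \<delta> k j) / p j) + (of_real (a j) * E j) * (of_real (a k) * E k) =
         (w\<^sup>2 - 1) * ((of_real (a j) * (\<epsilon> j / p j)) * (of_real (a k) * (\<epsilon> k / p k)))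
         - (if j = k then 2 * of_real pi * (of_real ((a j)\<^sup>2) / p j) else 0)" .
  qed
  also have "\<dots> = (w\<^sup>2 - 1) * (\<Sum>k\<in>A. of_real (a k) * (\<epsilon> k / p k))\<^sup>2 - (\<Sum>j\<in>A. 2 * of_real pi * (of_real ((a j)\<^sup>2) / p j))"
  proof -
    have "(\<Sum>j\<in>A. \<Sum>k\<in>A. (w\<^sup>2 - 1) * ((of_real (a j) * (\<epsilon> j / p j)) * (of_real (a k) * (\<epsilon> k / p k))))
       = (w\<^sup>2 - 1) * (\<Sum>k\<in>A. of_real (a k) * (\<epsilon> k / p k))\<^sup>2"
      unfolding power2_eq_square[of "\<Sum>k\<in>A. of_real (a k) * (\<epsilon> k / p k)"] sum_product
      by (simp only: sum_distrib_left)
    moreover have "(\<Sum>j\<in>A. \<Sum>k\<in>A. if j = k then 2 * of_real pi * (of_real ((a j)\<^sup>2) / p j) else 0)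
       = (\<Sum>j\<in>A. 2 * of_real pi * (of_real ((a j)\<^sup>2) / p j))"
      using A by (intro sum.cong refl) (simp add: sum.delta')
    ultimately show ?thesis by (simp only: sum_subtractf)
  qed
  also have "(\<Sum>j\<in>A. 2 * of_real pi * (of_real ((a j)\<^sup>2) / p j)) = 2 * of_real pi * (\<Sum>k\<in>A. of_real ((a k)\<^sup>2) / p k)"
    by (simp add: sum_distrib_left)
  finally show ?thesis .
qed

lemma char_fun_real_vec:
  "char_fun \<alpha> \<beta> \<mu> (real_vec u) z =
     sin (z * of_real pi - of_real \<alpha> + of_real \<beta>) - of_real \<mu> / 4 *
       (exp (\<i> * (z * of_real pi + of_real \<beta> - of_real \<alpha>))
          * (2 * Phi_fun u z + (exp (\<i> * of_real \<alpha>) * fourier_0_pi u z)\<^sup>2)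
        + exp (- \<i> * (z * of_real pi + of_real \<beta> - of_real \<alpha>))
          * cnj (2 * Phi_fun u (cnj z) + (exp (\<i> * of_real \<alpha>) * fourier_0_pi u (cnj z))\<^sup>2))"
  by (simp only: char_fun_def conj_fun_def R_fun_real_vec)

text \<open>This is the resolvent formula for v = sum a_k y_k. The outer exponentials are the
  inverse of \<open>w z\<close> and \<open>w z\<close> itself, so the two multiples of the square, w
  - 1/w and 1/w - w, are opposite. The diagonal terms acquire the factor w - 1/w, which is a
  multiple of the unperturbed characteristic function.\<close>

lemma char_fun_trig_poly:
  assumes A: "finite A" and z: "Im z \<noteq> 0"
  shows "char_fun \<alpha> \<beta> \<mu> (real_vec (trig_poly A a ((\<alpha> - \<beta>) / pi) \<alpha>)) z =
     sin (z * of_real pi - of_real \<alpha> + of_real \<beta>) *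
       (1 - (\<Sum>k\<in>A. of_real (\<mu> * pi * (a k)\<^sup>2) / (z - of_real (lambda0 \<alpha> \<beta> k))))"
proof -
  define \<gamma> where "\<gamma> = (\<alpha> - \<beta>) / pi"
  define p where "p = (\<lambda>z (k::int). \<i> * (of_real (of_int k + \<gamma>) - z))"
  define \<epsilon> where "\<epsilon> = (\<lambda>k::int. complex_of_real (cos (pi * of_int k)))"
  define w where "w = (\<lambda>z. exp (\<i> * of_real pi * (of_real \<gamma> - z)))"
  define R where "R = R_fun \<alpha> (real_vec (trig_poly A a \<gamma> \<alpha>))"
  define S where "S = (\<Sum>k\<in>A. of_real (a k) * (\<epsilon> k / p z k))"
  define T where "T = (\<Sum>k\<in>A. of_real ((a k)\<^sup>2) / p z k)"
  define \<theta> where "\<theta> = z * of_real pi - of_real \<alpha> + of_real \<beta>"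
  have p0: "p u k \<noteq> 0" if "Im u \<noteq> 0" for u k using that by (auto simp: p_def complex_eq_iff)
  have R: "R u = ((w u)\<^sup>2 - 1) * (\<Sum>k\<in>A. of_real (a k) * (\<epsilon> k / p u k))\<^sup>2 - 2 * of_real pi * (\<Sum>k\<in>A. of_real ((a k)\<^sup>2) / p u k)"
    if "Im u \<noteq> 0" for u
    unfolding R_def \<epsilon>_def p_def w_def by (rule R_fun_trig_poly[OF A p0[OF that, unfolded p_def]])
  have Rz: "R z = ((w z)\<^sup>2 - 1) * S\<^sup>2 - 2 * of_real pi * T"
    unfolding S_def T_def by (rule R[OF z])
  \<comment> \<open>Conjugating at the conjugate point negates every p_k and inverts w: the sum
    \<open>T\<close> changes sign, while the square of \<open>S\<close> does not.\<close>
  have cp: "cnj (p (cnj z) k) = - p z k" for k by (simp add: p_def)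
  have cw: "cnj (w (cnj z)) = inverse (w z)"
    unfolding w_def exp_cnj by (simp add: exp_minus[symmetric])
  have c\<epsilon>: "cnj (\<epsilon> k) = \<epsilon> k" for k unfolding \<epsilon>_def by (rule complex_cnj_complex_of_real)
  have "cnj (R (cnj z)) = ((inverse (w z))\<^sup>2 - 1) * (- S)\<^sup>2 - 2 * of_real pi * (- T)"
  proof -
    have "cnj (\<Sum>k\<in>A. of_real (a k) * (\<epsilon> k / p (cnj z) k)) = - S"
      unfolding cnj_sum complex_cnj_mult complex_cnj_divide cp c\<epsilon> S_def by (simp add: sum_negf)
    moreover have "cnj (\<Sum>k\<in>A. of_real ((a k)\<^sup>2) / p (cnj z) k) = - T"
      unfolding cnj_sum complex_cnj_divide cp T_def complex_cnj_complex_of_real by (simp add: sum_negf)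
    moreover have "R (cnj z) = ((w (cnj z))\<^sup>2 - 1) * (\<Sum>k\<in>A. of_real (a k) * (\<epsilon> k / p (cnj z) k))\<^sup>2 - 2 * of_real pi * (\<Sum>k\<in>A. of_real ((a k)\<^sup>2) / p (cnj z) k)"
      using z by (intro R) simp
    ultimately show ?thesis using cw
      by (simp only: complex_cnj_diff complex_cnj_mult complex_cnj_power complex_cnj_one complex_cnj_complex_of_real complex_cnj_numeral)
  qed
  hence Rc: "cnj (R (cnj z)) = ((inverse (w z))\<^sup>2 - 1) * S\<^sup>2 + 2 * of_real pi * T" by simp
  have w_exp: "w z = exp (- \<i> * \<theta>)"
  proof -
    have "of_real pi * of_real \<gamma> = complex_of_real (pi * \<gamma>)" by simp
    also have "pi * \<gamma> = \<alpha> - \<beta>" by (simp add: \<gamma>_def)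
    finally have "\<i> * of_real pi * (of_real \<gamma> - z) = \<i> * of_real (\<alpha> - \<beta>) - \<i> * of_real pi * z"
      by (simp only: right_diff_distrib mult.assoc)
    also have "\<dots> = - \<i> * \<theta>" by (simp add: \<theta>_def algebra_simps)
    finally show ?thesis unfolding w_def by (rule arg_cong)
  qed
  have w0: "w z \<noteq> 0" by (simp add: w_def)
  have iw: "inverse (w z) = exp (\<i> * \<theta>)" unfolding w_exp by (simp add: exp_minus[symmetric])
  \<comment> \<open>the terms with \<open>S\<^sup>2\<close> cancel\<close>
  have "inverse (w z) * R z + w z * cnj (R (cnj z)) = 2 * of_real pi * T * (w z - inverse (w z))"
    unfolding Rz Rc using w0 by (simp add: field_simps power2_eq_square)
  also have "w z - inverse (w z) = - 2 * \<i> * sin \<theta>"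
    unfolding iw w_exp by (simp add: sin_exp_eq field_simps exp_minus_inverse)
  also have "T = \<i> * (\<Sum>k\<in>A. of_real ((a k)\<^sup>2) / (z - of_real (lambda0 \<alpha> \<beta> k)))"
    unfolding T_def sum_distrib_left
  proof (intro sum.cong refl)
    fix k
    have "lambda0 \<alpha> \<beta> k = of_int k + \<gamma>" by (simp only: lambda0_def \<gamma>_def)
    hence "p z k = - \<i> * (z - of_real (lambda0 \<alpha> \<beta> k))" unfolding p_def by (simp add: algebra_simps)
    moreover have "c / (- \<i> * d) = \<i> * (c / d)" for c d :: complex
      by (cases "d = 0") (simp_all add: field_simps)
    ultimately show "of_real ((a k)\<^sup>2) / p z k = \<i> * (of_real ((a k)\<^sup>2) / (z - of_real (lambda0 \<alpha> \<beta> k)))"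
      by (simp only:)
  qed
  finally have sum_eq: "exp (\<i> * \<theta>) * R z + exp (- \<i> * \<theta>) * cnj (R (cnj z)) =
      4 * of_real pi * sin \<theta> * (\<Sum>k\<in>A. of_real ((a k)\<^sup>2) / (z - of_real (lambda0 \<alpha> \<beta> k)))"
    unfolding iw w_exp[symmetric] by (simp add: algebra_simps)
  have \<theta>': "z * of_real pi + of_real \<beta> - of_real \<alpha> = \<theta>" by (simp add: \<theta>_def)
  have "char_fun \<alpha> \<beta> \<mu> (real_vec (trig_poly A a \<gamma> \<alpha>)) z = sin \<theta> - of_real \<mu> / 4 * (exp (\<i> * \<theta>) * R z + exp (- \<i> * \<theta>) * cnj (R (cnj z)))"
    unfolding char_fun_def conj_fun_def R_def[symmetric] \<theta>' \<theta>_def[symmetric] ..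
  also have "\<dots> = sin \<theta> * (1 - (\<Sum>k\<in>A. of_real (\<mu> * pi * (a k)\<^sup>2) / (z - of_real (lambda0 \<alpha> \<beta> k))))"
    unfolding sum_eq by (simp add: algebra_simps sum_distrib_left)
  finally show ?thesis unfolding \<gamma>_def \<theta>_def .
qed

lemma tendsto_char_fun:
  assumes "\<And>j. f j \<in> borel_measurable lborel" "g \<in> borel_measurable lborel"
    and "set_integrable lborel {0..pi} D"
    and "AE x in lborel. x \<in> {0..pi} \<longrightarrow> (\<forall>j. norm (f j x) \<le> D x) \<and> (\<lambda>j. f j x) \<longlonglongrightarrow> g x"
    and z: "\<zeta> \<longlonglongrightarrow> z"
  shows "(\<lambda>j. char_fun \<alpha> \<beta> \<mu> (real_vec (f j)) (\<zeta> j)) \<longlonglongrightarrow> char_fun \<alpha> \<beta> \<mu> (real_vec g) z"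
proof -
  have "(\<lambda>j. cnj (\<zeta> j)) \<longlonglongrightarrow> cnj z" using z by (rule tendsto_cnj)
  thus ?thesis unfolding char_fun_real_vec
    by (intro tendsto_intros tendsto_Phi_fun[OF assms(1-4)] tendsto_fourier_0_pi[OF assms(1-4)] z)
qed

section \<open>The class J\<close>

lemma conj_fun_eq_imp_real:
  assumes "conj_fun f = f"
  shows "f (of_real x) \<in> \<real>"
  using fun_cong[OF assms, of "of_real x"] by (simp add: conj_fun_def Reals_cnj_iff)

text \<open>The factor exp (\<i> pi z) has modulus exp (- pi Im z), which makes the product bounded
  by M on both sides of the first quadrant while keeping its growth exponential. The remaining
  quadrants follow from z -> -z and from the symmetry under conjugation.\<close>

lemma exponential_type_bound_strip:
  assumes hol: "f holomorphic_on UNIV" and sym: "conj_fun f = f"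
    and growth: "\<And>z. norm (f z) \<le> C * exp (c * norm z)"
    and re: "\<And>x::real. norm (f (of_real x)) \<le> M"
    and im: "\<And>y. y \<ge> 0 \<Longrightarrow> norm (f (\<i> * of_real y)) \<le> M * exp (pi * y)"
    and M: "M > 0"
  shows "norm (f z) \<le> M * exp (pi * \<bar>Im z\<bar>)"
proof -
  have cnj: "f (cnj z) = cnj (f z)" for z
    using fun_cong[OF sym, of z] by (simp add: conj_fun_def) (metis complex_cnj_cnj)
  have quadrant: "norm (g z) \<le> M * exp (pi * Im z)"
    if g: "g holomorphic_on UNIV" "\<And>z. norm (g z) \<le> C * exp (c * norm z)"
      "\<And>x::real. norm (g (of_real x)) \<le> M"
      "\<And>y. y \<ge> 0 \<Longrightarrow> norm (g (\<i> * of_real y)) \<le> M * exp (pi * y)"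
      and z: "Re z \<ge> 0" "Im z \<ge> 0" for g z
  proof -
    define h where "h = (\<lambda>z. g z * exp (\<i> * of_real pi * z))"
    have nh: "norm (h z) = norm (g z) * exp (- (pi * Im z))" for z
      by (simp add: h_def norm_mult)
    have "norm (h z) \<le> M"
    proof (rule phragmen_lindelof_quadrant[OF _ _ _ _ M z])
      show "h holomorphic_on UNIV" unfolding h_def by (intro holomorphic_intros g(1))
      show "norm (h z) \<le> C * exp ((c + pi) * norm z)" for z
      proof -
        have "- (pi * Im z) \<le> pi * norm z"
          using mult_left_mono[OF abs_Im_le_cmod[of z], of pi] by (smt (verit) mult_minus_right mult_left_mono pi_ge_zero)
        hence "norm (h z) \<le> (C * exp (c * norm z)) * exp (pi * norm z)"
          unfolding nh using g(2)[of z] order_trans[OF norm_ge_zero g(2)] by (intro mult_mono) auto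
        thus ?thesis by (simp add: distrib_right exp_add mult.assoc)
      qed
      show "norm (h (of_real x)) \<le> M" for x using g(3)[of x] by (simp add: nh)
      show "norm (h (\<i> * of_real y)) \<le> M" if "y \<ge> 0" for y
        using g(4)[OF that] by (simp add: nh exp_minus field_simps)
    qed
    thus ?thesis by (simp add: nh exp_minus field_simps)
  qed
  have neg: "(\<lambda>z. f (- z)) holomorphic_on UNIV"
  proof -
    have "f \<circ> uminus holomorphic_on UNIV"
      by (intro holomorphic_on_compose holomorphic_intros holomorphic_on_subset[OF hol]) auto
    thus ?thesis by (simp add: o_def)
  qed
  have im': "norm (f (- (\<i> * of_real y))) \<le> M * exp (pi * y)" if "y \<ge> 0" for y
    using im[OF that] cnj[of "\<i> * of_real y"] by simp
  have neg_quadrant: "norm (f (- z)) \<le> M * exp (pi * Im z)" if "Re z \<ge> 0" "Im z \<ge> 0" for z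
    by (rule quadrant[OF neg _ _ im' that]) (use growth[of "- z" for z] re[of "- x" for x] in simp_all)
  have upper: "norm (f z) \<le> M * exp (pi * Im z)" if "Im z \<ge> 0" for z
  proof (cases "Re z \<ge> 0")
    case True
    thus ?thesis using quadrant[OF hol growth re im] that by blast
  next
    case False
    \<comment> \<open>The reflection - cnj z of a point of the second quadrant lies in the first and
      has the same imaginary part.\<close>
    have "norm (f z) = norm (f (- (- cnj z)))" using cnj[of z] by simp
    also have "\<dots> \<le> M * exp (pi * Im (- cnj z))" using False that by (intro neg_quadrant) auto
    finally show ?thesis by simp
  qed
  show ?thesis
  proof (cases "Im z \<ge> 0")
    case True
    thus ?thesis using upper by simp
  next
    case False
    have "norm (f z) = norm (f (cnj z))" using cnj[of z] by simp
    also have "\<dots> \<le> M * exp (pi * Im (cnj z))" using False by (intro upper) auto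
    finally show ?thesis using False by simp
  qed
qed

lemma sin_shift_lambda0:
  fixes z :: complex
  shows "sin (z * of_real pi - of_real \<alpha> + of_real \<beta>) = sin (of_real pi * (z - of_real ((\<alpha> - \<beta>) / pi)))"
proof -
  have "of_real pi * of_real ((\<alpha> - \<beta>) / pi) = complex_of_real (pi * ((\<alpha> - \<beta>) / pi))" by simp
  also have "pi * ((\<alpha> - \<beta>) / pi) = \<alpha> - \<beta>" by simp
  finally have "of_real pi * (z - of_real ((\<alpha> - \<beta>) / pi)) = of_real pi * z - of_real (\<alpha> - \<beta>)"
    by (simp only: right_diff_distrib)
  also have "\<dots> = z * of_real pi - of_real \<alpha> + of_real \<beta>" by (simp add: algebra_simps)
  finally show ?thesis by (simp only:)
qed

lemma sin_shift_eq_0_iff: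
  fixes z :: complex
  shows "sin (z * of_real pi - of_real \<alpha> + of_real \<beta>) = 0 \<longleftrightarrow> z \<in> range (\<lambda>k. of_real (lambda0 \<alpha> \<beta> k))"
proof -
  have "z - of_real ((\<alpha> - \<beta>) / pi) \<in> \<int> \<longleftrightarrow> (\<exists>k. z = of_real (lambda0 \<alpha> \<beta> k))"
  proof
    assume "z - of_real ((\<alpha> - \<beta>) / pi) \<in> \<int>"
    then obtain k where "z - of_real ((\<alpha> - \<beta>) / pi) = of_int k" by (auto elim: Ints_cases)
    hence "z = of_int k + of_real ((\<alpha> - \<beta>) / pi)" by (simp only: diff_eq_eq)
    thus "\<exists>k. z = of_real (lambda0 \<alpha> \<beta> k)" by (auto simp: lambda0_def)
  next
    assume "\<exists>k. z = of_real (lambda0 \<alpha> \<beta> k)"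
    then obtain k where "z = of_int k + of_real ((\<alpha> - \<beta>) / pi)" by (auto simp: lambda0_def)
    hence "z - of_real ((\<alpha> - \<beta>) / pi) = of_int k" by (simp only: add_diff_cancel_right')
    thus "z - of_real ((\<alpha> - \<beta>) / pi) \<in> \<int>" by simp
  qed
  thus ?thesis unfolding sin_shift_lambda0 sin_pi_times_eq_0_iff by auto
qed

text \<open>Boundedness on the real axis gives one side of the quadrant. On the other side, F (\<i>
  y) -> 1 compares Delta with the sine, whose growth is exp (pi y).\<close>

lemma class_J_exponential_bound:
  assumes "\<Delta> \<in> class_J \<alpha> \<beta>"
  obtains M where "\<And>z. norm (\<Delta> z) \<le> M * exp (pi * \<bar>Im z\<bar>)"
proof -
  obtain \<sigma> where J: "\<Delta> holomorphic_on UNIV" "exponential_type \<Delta> \<sigma>" "bounded (\<Delta> ` \<real>)" "conj_fun \<Delta> = \<Delta>"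
     "((\<lambda>y::real. F_fun \<alpha> \<beta> \<Delta> (\<i> * of_real y)) \<longlongrightarrow> 1) at_top"
    using assms unfolding class_J_def by blast
  obtain C where C: "\<And>z. norm (\<Delta> z) \<le> C * exp ((\<sigma> + 1) * norm z)"
    using J(2) unfolding exponential_type_def by (metis zero_less_one)
  obtain M1 where M1: "\<And>x::real. norm (\<Delta> (of_real x)) \<le> M1"
    using J(3) unfolding bounded_iff by (metis Reals_of_real imageI)
  have "eventually (\<lambda>y::real. dist (F_fun \<alpha> \<beta> \<Delta> (\<i> * of_real y)) 1 < 1) at_top"
    using J(5) unfolding tendsto_iff by auto
  then obtain Y where Y: "\<And>y. y \<ge> Y \<Longrightarrow> dist (F_fun \<alpha> \<beta> \<Delta> (\<i> * of_real y)) 1 < 1"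
    unfolding eventually_at_top_linorder by blast
  \<comment> \<open>Below max Y 1 compactness bounds Delta. The 1 keeps y positive in the opposite
    case, so that the sine does not vanish at \<i> y.\<close>
  have "compact ((\<lambda>y::real. \<Delta> (\<i> * of_real y)) ` {0..max Y 1})"
    by (intro compact_continuous_image continuous_on_compose2[OF holomorphic_on_imp_continuous_on[OF J(1)]] continuous_intros) auto
  then obtain M2 where "\<forall>u\<in>(\<lambda>y::real. \<Delta> (\<i> * of_real y)) ` {0..max Y 1}. norm u \<le> M2"
    using compact_imp_bounded bounded_iff by metis
  hence M2: "norm (\<Delta> (\<i> * of_real y)) \<le> M2" if "0 \<le> y" "y \<le> max Y 1" for y :: real
    using that by auto
  \<comment> \<open>The entry 2 is the bound for the modulus of F (\<i> y) once it is within
    distance 1 of its limit.\<close>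
  define M where "M = max (max M1 M2) 2"
  have "norm (\<Delta> z) \<le> M * exp (pi * \<bar>Im z\<bar>)" for z
  proof (rule exponential_type_bound_strip[OF J(1,4) C])
    show "norm (\<Delta> (of_real x)) \<le> M" for x using M1[of x] by (simp add: M_def)
    show "M > 0" by (simp add: M_def)
    fix y :: real assume y: "y \<ge> 0"
    show "norm (\<Delta> (\<i> * of_real y)) \<le> M * exp (pi * y)"
    proof (cases "y \<le> max Y 1")
      case True
      have "norm (\<Delta> (\<i> * of_real y)) \<le> M" using M2[OF y True] by (simp add: M_def)
      also have "M \<le> M * exp (pi * y)"
        using y mult_left_mono[of 1 "exp (pi * y)" M] by (simp add: M_def)
      finally show ?thesis .
    next
      case False
      define s where "s = sin (\<i> * of_real y * of_real pi - of_real \<alpha> + of_real \<beta>)"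
      have "\<i> * of_real y \<notin> range (\<lambda>k. complex_of_real (lambda0 \<alpha> \<beta> k))"
        using False by (auto simp: complex_eq_iff)
      hence "s \<noteq> 0" unfolding s_def sin_shift_eq_0_iff .
      hence "\<Delta> (\<i> * of_real y) = F_fun \<alpha> \<beta> \<Delta> (\<i> * of_real y) * s" by (simp add: F_fun_def s_def)
      hence "norm (\<Delta> (\<i> * of_real y)) = norm (F_fun \<alpha> \<beta> \<Delta> (\<i> * of_real y)) * norm s" by (simp add: norm_mult)
      also have "\<dots> \<le> 2 * exp (pi * y)"
      proof (rule mult_mono)
        have "norm (F_fun \<alpha> \<beta> \<Delta> (\<i> * of_real y)) \<le> norm (F_fun \<alpha> \<beta> \<Delta> (\<i> * of_real y) - 1) + norm (1::complex)"
          by (metis diff_add_cancel norm_triangle_ineq)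
        moreover have "Y \<le> y" using False by simp
        ultimately show "norm (F_fun \<alpha> \<beta> \<Delta> (\<i> * of_real y)) \<le> 2" using Y[of y] by (simp add: dist_norm)
        show "norm s \<le> exp (pi * y)" unfolding s_def
          using norm_sin_le_exp[of "\<i> * of_real y * of_real pi - of_real \<alpha> + of_real \<beta>"] y by (simp add: mult.commute)
      qed auto
      also have "\<dots> \<le> M * exp (pi * y)" by (intro mult_right_mono) (auto simp: M_def)
      finally show ?thesis .
    qed
  qed
  thus ?thesis by (rule that)
qed

section \<open>Orders of zeros and signs of the residues at the eigenvalues\<close>

lemma zorder_diff_const: "zorder (\<lambda>z. z - a) t = of_bool (t = a)" for a t :: complex
proof (cases "t = a")
  case True
  have "zorder (\<lambda>z. z - a) a = 1"
    by (rule zorder_eqI[of UNIV a "\<lambda>_. 1"]) auto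
  thus ?thesis using True by simp
next
  case False
  hence "zorder (\<lambda>z. z - a) t = 0"
    by (intro zorder_eq_0I) (auto intro!: analytic_intros)
  thus ?thesis using False by simp
qed

lemma deriv_sin_shift:
  "((\<lambda>z. sin (z * of_real pi - of_real \<alpha> + of_real \<beta>)) has_field_derivative
     of_real (pi * cos (pi * of_int k))) (at (of_real (lambda0 \<alpha> \<beta> k) :: complex))"
proof -
  have "pi * (lambda0 \<alpha> \<beta> k - (\<alpha> - \<beta>) / pi) = pi * of_int k" by (simp add: lambda0_def)
  moreover have "of_real pi * (of_real (lambda0 \<alpha> \<beta> k) - of_real ((\<alpha> - \<beta>) / pi)) =
      complex_of_real (pi * (lambda0 \<alpha> \<beta> k - (\<alpha> - \<beta>) / pi))" by (simp only: of_real_mult of_real_diff)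
  ultimately have "cos (of_real pi * (of_real (lambda0 \<alpha> \<beta> k) - of_real ((\<alpha> - \<beta>) / pi))) = complex_of_real (cos (pi * of_int k))"
    by (simp only: cos_of_real)
  moreover have "((\<lambda>z. sin (of_real pi * (z - of_real ((\<alpha> - \<beta>) / pi)))) has_field_derivative
     cos (of_real pi * (of_real (lambda0 \<alpha> \<beta> k) - of_real ((\<alpha> - \<beta>) / pi))) * of_real pi) (at (of_real (lambda0 \<alpha> \<beta> k) :: complex))"
    by (auto intro!: derivative_eq_intros)
  ultimately show ?thesis unfolding sin_shift_lambda0 by (simp only: of_real_mult mult.commute)
qed

lemma holomorphic_sin_shift: "(\<lambda>z. sin (z * of_real pi - of_real \<alpha> + of_real \<beta>)) holomorphic_on A"
  by (intro holomorphic_intros)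

lemma zorder_sin_shift:
  fixes z :: complex
  shows "zorder (\<lambda>z. sin (z * of_real pi - of_real \<alpha> + of_real \<beta>)) z = of_bool (z \<in> range (\<lambda>k. of_real (lambda0 \<alpha> \<beta> k)))"
proof (cases "z \<in> range (\<lambda>k. of_real (lambda0 \<alpha> \<beta> k))")
  case True
  then obtain k where k: "z = of_real (lambda0 \<alpha> \<beta> k)" by auto
  have "zorder (\<lambda>z. sin (z * of_real pi - of_real \<alpha> + of_real \<beta>)) z = 1"
  proof (rule zorder_zero_eqI[OF holomorphic_sin_shift[of _ _ UNIV]])
    show "(deriv ^^ nat 1) (\<lambda>z. sin (z * of_real pi - of_real \<alpha> + of_real \<beta>)) z \<noteq> 0"
      using DERIV_imp_deriv[OF deriv_sin_shift[of \<alpha> \<beta> k]] k by simp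
    fix i :: nat assume "i < nat 1"
    thus "(deriv ^^ i) (\<lambda>z. sin (z * of_real pi - of_real \<alpha> + of_real \<beta>)) z = 0"
      using True sin_shift_eq_0_iff[of z \<alpha> \<beta>] by simp
  qed auto
  thus ?thesis using True by simp
next
  case False
  hence "zorder (\<lambda>z. sin (z * of_real pi - of_real \<alpha> + of_real \<beta>)) z = 0"
    by (intro zorder_eq_0I) (auto simp: sin_shift_eq_0_iff intro!: analytic_intros)
  thus ?thesis using False by simp
qed

lemma tendsto_diff_div_sin_shift:
  "((\<lambda>z. (z - of_real (lambda0 \<alpha> \<beta> k)) / sin (z * of_real pi - of_real \<alpha> + of_real \<beta>))
     \<longlongrightarrow> of_real (cos (pi * of_int k) / pi)) (at (of_real (lambda0 \<alpha> \<beta> k) :: complex))"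
proof -
  define l where "l = complex_of_real (lambda0 \<alpha> \<beta> k)"
  define s where "s = (\<lambda>z::complex. sin (z * of_real pi - of_real \<alpha> + of_real \<beta>))"
  have "s l = 0" unfolding s_def l_def sin_shift_eq_0_iff by blast
  hence "((\<lambda>z. s z / (z - l)) \<longlongrightarrow> of_real (pi * cos (pi * of_int k))) (at l)"
    using deriv_sin_shift[of \<alpha> \<beta> k] unfolding has_field_derivative_iff s_def[symmetric] l_def[symmetric] by simp
  hence "((\<lambda>z. inverse (s z / (z - l))) \<longlongrightarrow> inverse (of_real (pi * cos (pi * of_int k)))) (at l)"
    by (rule tendsto_inverse) auto
  moreover have "inverse (of_real (pi * cos (pi * of_int k))) = complex_of_real (cos (pi * of_int k) / pi)"
    by (simp add: field_simps)
  ultimately have "((\<lambda>z. (z - l) / s z) \<longlongrightarrow> of_real (cos (pi * of_int k) / pi)) (at l)" by simp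
  thus ?thesis unfolding s_def l_def .
qed

text \<open>Multiplying \<open>\<Delta>(z) / sin\<close> by \<open>(z - l\<^sub>j)(z - l\<^sub>k) / (z - b)\<close>, where \<open>b\<close> is the point of \<open>B1\<close>
  between the consecutive points \<open>l\<^sub>j, l\<^sub>k\<close> of \<open>A1\<close>, cancels every zero and pole on \<open>[l\<^sub>j, l\<^sub>k]\<close>.\<close>
lemma residues_consecutive_same_sign:
  fixes \<Delta> :: "complex \<Rightarrow> complex"
  assumes hol: "\<Delta> holomorphic_on UNIV" and nz: "\<Delta> u \<noteq> 0" and sym: "conj_fun \<Delta> = \<Delta>"
    and A: "A0 \<union> A1 = range (lambda0 \<alpha> \<beta>)" "A0 \<inter> A1 = {}" and int: "interlaced A1 B1"
    and ord: "\<And>z. zorder \<Delta> z = of_bool (z \<in> of_real ` A0) + of_bool (z \<in> of_real ` B1)"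
    and cons: "consecutive_in A1 (lambda0 \<alpha> \<beta> j) (lambda0 \<alpha> \<beta> k)"
  shows "(cos (pi * of_int j) * Re (\<Delta> (of_real (lambda0 \<alpha> \<beta> j))))
       * (cos (pi * of_int k) * Re (\<Delta> (of_real (lambda0 \<alpha> \<beta> k)))) > 0"
proof -
  define lj lk where "lj = lambda0 \<alpha> \<beta> j" and "lk = lambda0 \<alpha> \<beta> k"
  define s where "s = (\<lambda>z::complex. sin (z * of_real pi - of_real \<alpha> + of_real \<beta>))"
  have lt: "lj < lk" and jkA: "lj \<in> A1" "lk \<in> A1" and empty: "A1 \<inter> {lj<..<lk} = {}"
    using cons by (auto simp: consecutive_in_def lj_def lk_def)
  obtain b where b: "b \<in> B1" "lj < b" "b < lk" and b_unique: "\<And>b'. b' \<in> B1 \<Longrightarrow> lj < b' \<Longrightarrow> b' < lk \<Longrightarrow> b' = b"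
    using int cons unfolding interlaced_def lj_def lk_def by metis
  have disj: "A1 \<inter> B1 = {}" using int by (simp add: interlaced_def)
  define f where "f = (\<lambda>z. \<Delta> z * ((z - of_real lj) * (z - of_real lk)))"
  define g where "g = (\<lambda>z. s z * (z - of_real b))"
  have hs: "s holomorphic_on UNIV" unfolding s_def by (rule holomorphic_sin_shift)
  have hf: "f holomorphic_on UNIV" unfolding f_def by (intro holomorphic_intros hol)
  have hg: "g holomorphic_on UNIV" unfolding g_def by (intro holomorphic_intros hs)
  have an: "h analytic_on {t}" if "h holomorphic_on UNIV" for h and t :: complex
    using that by (auto intro: analytic_on_subset[of _ UNIV] simp: analytic_on_open)
  have ev_ne: "eventually (\<lambda>z. z \<noteq> c) (at t)" for c t :: complex
    by (rule eventually_neq_at_within)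
  have ev_D: "eventually (\<lambda>z. \<Delta> z \<noteq> 0) (at t)" for t
    using non_zero_neighbour_alt[OF hol _ _ _ _ nz, of t] by (auto elim: eventually_mono)
  have s1: "s (\<i> + of_real lj) \<noteq> 0" unfolding s_def sin_shift_eq_0_iff by (auto simp: complex_eq_iff)
  have ev_s: "eventually (\<lambda>z. s z \<noteq> 0) (at t)" for t
    using non_zero_neighbour_alt[OF hs _ _ _ _ s1, of t] by (auto elim: eventually_mono)
  have zf: "zorder f t = zorder \<Delta> t + of_bool (t = of_real lj) + of_bool (t = of_real lk)" for t
  proof -
    have "zorder (\<lambda>z. (z - of_real lj) * (z - of_real lk)) t = of_bool (t = of_real lj) + of_bool (t = of_real lk)"
      by (subst zorder_times_analytic)
        (auto simp: zorder_diff_const intro!: analytic_intros eventually_mono[OF eventually_conj[OF ev_ne ev_ne]])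
    moreover have "zorder f t = zorder \<Delta> t + zorder (\<lambda>z. (z - of_real lj) * (z - of_real lk)) t"
      unfolding f_def
    proof (rule zorder_times_analytic[OF an[OF hol]])
      show "eventually (\<lambda>z. \<Delta> z * ((z - of_real lj) * (z - of_real lk)) \<noteq> 0) (at t)"
        using ev_D[of t] ev_ne[of "of_real lj" t] ev_ne[of "of_real lk" t] by eventually_elim auto
    qed (auto intro!: analytic_intros)
    ultimately show ?thesis by simp
  qed
  have zg: "zorder g t = of_bool (t \<in> range (\<lambda>k. of_real (lambda0 \<alpha> \<beta> k))) + of_bool (t = of_real b)" for t
  proof -
    have "zorder g t = zorder s t + zorder (\<lambda>z. z - of_real b) t"
      unfolding g_def
    proof (rule zorder_times_analytic[OF an[OF hs]])
      show "eventually (\<lambda>z. s z * (z - of_real b) \<noteq> 0) (at t)"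
        using ev_s[of t] ev_ne[of "of_real b" t] by eventually_elim auto
    qed (auto intro!: analytic_intros)
    thus ?thesis by (simp only: zorder_diff_const zorder_sin_shift s_def)
  qed
  \<comment> \<open>At points of A0 the zeros of Delta and of the sine match. At the two ends, which
    lie in A1, Delta does not vanish and the linear factors of \<open>f\<close> replace the zero. If
    \<open>b\<close> belongs to A0 as well, it is a double zero of Delta, matched by the sine and
    the factor z - b together.\<close>
  have ord_eq: "zorder f (of_real t) = zorder g (of_real t)" if t: "lj \<le> t" "t \<le> lk" for t
  proof -
    have "complex_of_real t \<in> range (\<lambda>k. of_real (lambda0 \<alpha> \<beta> k)) \<longleftrightarrow> t \<in> A0 \<union> A1" unfolding A(1) by auto
    moreover have "t \<in> A1 \<longleftrightarrow> t = lj \<or> t = lk" using jkA empty t by (cases "t = lj"; cases "t = lk") auto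
    moreover have "t \<in> B1 \<longleftrightarrow> t = b"
      using b b_unique[of t] disj jkA t by (cases "t = lj"; cases "t = lk") auto
    moreover have "of_real t \<in> complex_of_real ` X \<longleftrightarrow> t \<in> X" for X by auto
    ultimately show ?thesis unfolding zf zg ord using A(2) jkA b lt by (auto simp: of_bool_def)
  qed
  have fnz: "\<exists>u. f u \<noteq> 0"
  proof -
    have "eventually (\<lambda>z. f z \<noteq> 0) (at 0)"
      using ev_D[of 0] ev_ne[of "of_real lj" 0] ev_ne[of "of_real lk" 0] by eventually_elim (auto simp: f_def)
    thus ?thesis using eventually_happens'[OF at_neq_bot] by blast
  qed
  then obtain u' where u': "f u' \<noteq> 0" by blast
  have gnz: "g (\<i> + of_real lj) \<noteq> 0" 
  proof -
    have "\<i> + of_real lj - of_real b \<noteq> 0" by (auto simp: complex_eq_iff)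
    thus ?thesis unfolding g_def using s1 by simp
  qed
  have real_D: "\<Delta> (of_real t) = of_real (Re (\<Delta> (of_real t)))" for t
    using conj_fun_eq_imp_real[OF sym, of t] by (auto elim: Reals_cases)
  have real_f: "f (of_real t) \<in> \<real>" for t
    unfolding f_def by (intro Reals_mult Reals_diff Reals_of_real conj_fun_eq_imp_real[OF sym])
  have real_g: "g (of_real t) \<in> \<real>" for t
  proof -
    have "s (of_real t) = of_real (sin (t * pi - \<alpha> + \<beta>))" unfolding s_def by (simp flip: sin_of_real)
    thus ?thesis unfolding g_def by (simp flip: of_real_diff of_real_mult)
  qed
  \<comment> \<open>At an end l_m, with \<open>c\<close> the other end, the limit is the residue
    times (l_m - c) / (l_m - b). Since \<open>b\<close> lies between the ends, this quotient is
    positive at both, and equal signs of the limits mean equal signs of the residues.\<close>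
  have lim: "((\<lambda>z. f z / g z) \<longlongrightarrow> of_real (Re (\<Delta> (of_real (lambda0 \<alpha> \<beta> m))) * (cos (pi * of_int m) / pi) * ((lambda0 \<alpha> \<beta> m - c) / (lambda0 \<alpha> \<beta> m - b))))
       (at (of_real (lambda0 \<alpha> \<beta> m)))"
    if m: "lambda0 \<alpha> \<beta> m \<noteq> b" "f = (\<lambda>z. \<Delta> z * ((z - of_real (lambda0 \<alpha> \<beta> m)) * (z - of_real c)))" for m c
  proof -
    define l where "l = lambda0 \<alpha> \<beta> m"
    have "(\<Delta> \<longlongrightarrow> \<Delta> (of_real l)) (at (of_real l))"
      using analytic_at_imp_isCont[OF an[OF hol]] by (simp add: isCont_def)
    hence "((\<lambda>z. \<Delta> z * ((z - of_real l) / s z) * ((z - of_real c) / (z - of_real b))) \<longlongrightarrow>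
        \<Delta> (of_real l) * of_real (cos (pi * of_int m) / pi) * ((of_real l - of_real c) / (of_real l - of_real b))) (at (of_real l))"
      using m(1) tendsto_diff_div_sin_shift[of \<alpha> \<beta> m] unfolding s_def l_def by (intro tendsto_intros) auto
    moreover have "(\<lambda>z. \<Delta> z * ((z - of_real l) / s z) * ((z - of_real c) / (z - of_real b))) = (\<lambda>z. f z / g z)"
      unfolding m(2) g_def l_def by (simp add: fun_eq_iff)
    moreover have "\<Delta> (of_real l) * of_real (cos (pi * of_int m) / pi) * ((of_real l - of_real c) / (of_real l - of_real b))
       = of_real (Re (\<Delta> (of_real l)) * (cos (pi * of_int m) / pi) * ((l - c) / (l - b)))"
      by (subst real_D) (simp only: of_real_mult of_real_divide of_real_diff)
    ultimately show ?thesis unfolding l_def by (simp only:)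
  qed
  define P where "P = (\<lambda>m. Re (\<Delta> (of_real (lambda0 \<alpha> \<beta> m))) * cos (pi * of_int m))"
  have "Re (of_real (Re (\<Delta> (of_real lj)) * (cos (pi * of_int j) / pi) * ((lj - lk) / (lj - b))))
      * Re (of_real (Re (\<Delta> (of_real lk)) * (cos (pi * of_int k) / pi) * ((lk - lj) / (lk - b)))) > 0"
    unfolding lj_def lk_def
  proof (rule quotient_limits_same_sign[OF hf hg u' gnz real_f real_g])
    show "((\<lambda>z. f z / g z) \<longlongrightarrow> of_real (Re (\<Delta> (of_real (lambda0 \<alpha> \<beta> j))) * (cos (pi * of_int j) / pi) *
        ((lambda0 \<alpha> \<beta> j - lambda0 \<alpha> \<beta> k) / (lambda0 \<alpha> \<beta> j - b)))) (at (of_real (lambda0 \<alpha> \<beta> j)))"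
      using b by (intro lim) (auto simp: f_def lj_def lk_def)
    show "((\<lambda>z. f z / g z) \<longlongrightarrow> of_real (Re (\<Delta> (of_real (lambda0 \<alpha> \<beta> k))) * (cos (pi * of_int k) / pi) *
        ((lambda0 \<alpha> \<beta> k - lambda0 \<alpha> \<beta> j) / (lambda0 \<alpha> \<beta> k - b)))) (at (of_real (lambda0 \<alpha> \<beta> k)))"
      using b by (intro lim) (auto simp: f_def lj_def lk_def mult.commute)
    show "lambda0 \<alpha> \<beta> j \<le> lambda0 \<alpha> \<beta> k" using lt by (simp add: lj_def lk_def)
    show "zorder f (of_real t) = zorder g (of_real t)" if "lambda0 \<alpha> \<beta> j \<le> t" "t \<le> lambda0 \<alpha> \<beta> k" for t
      using ord_eq that by (simp add: lj_def lk_def)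
  qed
  hence "0 < (P j * P k) * ((lj - lk) / (lj - b) * ((lk - lj) / (lk - b)) / (pi * pi))"
    by (simp add: P_def lj_def lk_def mult_ac)
  moreover have "(lj - lk) / (lj - b) * ((lk - lj) / (lk - b)) / (pi * pi) > 0"
    using b lt by (intro divide_pos_pos mult_pos_pos divide_neg_neg) auto
  ultimately have "P j * P k > 0" by (simp only: zero_less_mult_iff) linarith
  thus ?thesis by (simp add: P_def mult_ac)
qed

text \<open>Having the same strict sign is transitive, so any two members are joined through the
  members between them; the induction is on their distance.\<close>

lemma products_positive_if_consecutive:
  fixes q :: "int \<Rightarrow> real"
  assumes "\<And>j k. j \<in> K \<Longrightarrow> k \<in> K \<Longrightarrow> j < k \<Longrightarrow> (\<forall>m\<in>K. \<not> (j < m \<and> m < k)) \<Longrightarrow> q j * q k > 0"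
    and "j \<in> K" "k \<in> K" "j < k"
  shows "q j * q k > 0"
  using assms(2-4)
proof (induction "nat (k - j)" arbitrary: j k rule: less_induct)
  case less
  show ?case
  proof (cases "\<exists>m\<in>K. j < m \<and> m < k")
    case True
    then obtain m where m: "m \<in> K" "j < m" "m < k" by blast
    have "q j * q m > 0" "q m * q k > 0" using m less.prems by (auto intro!: less.hyps)
    thus ?thesis by (smt (verit) zero_less_mult_iff)
  next
    case False
    thus ?thesis using assms(1) less.prems by blast
  qed
qed

text \<open>At eigenvalues in A0 Delta vanishes and the residue is 0. The others form A1, where
  equality of signs passes from consecutive points to all pairs.\<close>

lemma class_J_residues_one_signed:
  assumes J: "\<Delta> \<in> class_J \<alpha> \<beta>"
  obtains \<sigma> :: real where "\<bar>\<sigma>\<bar> = 1"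
    "\<And>k. \<sigma> * (cos (pi * of_int k) * Re (\<Delta> (of_real (lambda0 \<alpha> \<beta> k))) / pi) \<ge> 0"
proof -
  define l where "l = lambda0 \<alpha> \<beta>"
  define q where "q = (\<lambda>k. cos (pi * of_int k) * Re (\<Delta> (of_real (l k))))"
  have D: "\<Delta> holomorphic_on UNIV" "\<Delta> 0 \<noteq> 0" "conj_fun \<Delta> = \<Delta>" "partially_interlaces l \<Delta>"
    using J unfolding class_J_def l_def by blast+
  obtain A0 A1 B1 where A: "A0 \<union> A1 = range l" "A0 \<inter> A1 = {}" "interlaced A1 B1"
     and ord: "\<And>z. zorder \<Delta> z = of_bool (z \<in> of_real ` A0) + of_bool (z \<in> of_real ` B1)"
    using D(4) unfolding partially_interlaces_def by blast
  define K where "K = {k. l k \<in> A1}"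
  have mono: "l j < l k \<longleftrightarrow> j < k" for j k by (simp add: l_def lambda0_def)
  have q0: "q k = 0" if "k \<notin> K" for k
  proof -
    have "l k \<in> A0" using that A(1) by (auto simp: K_def)
    hence "zorder \<Delta> (of_real (l k)) > 0" unfolding ord by auto
    moreover have "frequently (\<lambda>z. \<Delta> z \<noteq> 0) (at (of_real (l k)))"
      using non_zero_neighbour_alt[OF D(1) _ _ _ _ D(2), of "of_real (l k)"]
      by (intro eventually_frequently) (auto elim: eventually_mono)
    ultimately have "\<Delta> (of_real (l k)) = 0" using zorder_pos_iff[OF D(1)] by auto
    thus ?thesis by (simp add: q_def)
  qed
  have pos: "q j * q k > 0" if "j \<in> K" "k \<in> K" "j < k" for j k
  proof (rule products_positive_if_consecutive[OF _ that])
    fix j k assume jk: "j \<in> K" "k \<in> K" "j < k" "\<forall>m\<in>K. \<not> (j < m \<and> m < k)"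
    have "A1 \<inter> {l j<..<l k} = {}"
    proof (rule ccontr)
      assume "A1 \<inter> {l j<..<l k} \<noteq> {}"
      then obtain x where x: "x \<in> A1" "l j < x" "x < l k" by auto
      then obtain m where "x = l m" using A(1) by blast
      thus False using x jk(4) by (auto simp: K_def mono)
    qed
    hence "consecutive_in A1 (l j) (l k)" using jk by (auto simp: consecutive_in_def K_def mono)
    thus "q j * q k > 0" unfolding q_def l_def
      by (intro residues_consecutive_same_sign[OF D(1,2,3) A[unfolded l_def] ord])
  qed
  \<comment> \<open>One negative value forces every nonzero value to be negative. The default 1 also
    covers the case in which all residues vanish.\<close>
  define \<sigma> :: real where "\<sigma> = (if \<exists>k. q k < 0 then -1 else 1)"
  have "\<sigma> * q k \<ge> 0" for k
  proof (cases "\<exists>m. q m < 0")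
    case True
    then obtain m where m: "q m < 0" by blast
    have "q k \<le> 0"
    proof (rule ccontr)
      assume "\<not> q k \<le> 0"
      hence k: "q k > 0" by simp
      hence "k \<in> K" "m \<in> K" "k \<noteq> m" using m q0[of k] q0[of m] by (force, force, force)
      hence "q k * q m > 0" using pos[of k m] pos[of m k] by (cases "k < m") (auto simp: mult.commute)
      thus False using k m by (simp add: zero_less_mult_iff)
    qed
    thus ?thesis using True by (simp add: \<sigma>_def)
  qed (auto simp: \<sigma>_def not_less)
  hence "\<sigma> * (q k / pi) \<ge> 0" for k by simp
  moreover have "\<bar>\<sigma>\<bar> = 1" by (simp add: \<sigma>_def)
  ultimately show ?thesis using that unfolding q_def l_def by blast
qed

text \<open>Translation by \<gamma> carries the poles to the integers, where the expansion was
  proved. It changes only the real part of the argument, so the bound in terms of |Im z|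
  persists.\<close>

lemma class_J_partial_fractions:
  assumes J: "\<Delta> \<in> class_J \<alpha> \<beta>"
  obtains \<sigma> r where "\<bar>\<sigma>\<bar> = (1::real)" "\<And>k. \<sigma> * r k \<ge> 0" "r summable_on UNIV"
    "\<And>z. Im z \<noteq> 0 \<Longrightarrow>
      (\<lambda>N. 1 + (\<Sum>k\<in>{-int N..int N}. of_real (r k) / (z - of_real (lambda0 \<alpha> \<beta> k)))) \<longlonglongrightarrow> F_fun \<alpha> \<beta> \<Delta> z"
proof -
  define \<gamma> where "\<gamma> = (\<alpha> - \<beta>) / pi"
  define l where "l = lambda0 \<alpha> \<beta>"
  have l: "complex_of_real (l k) = of_int k + of_real \<gamma>" for k by (simp add: l_def lambda0_def \<gamma>_def)
  define r where "r = (\<lambda>k. cos (pi * of_int k) * Re (\<Delta> (of_real (l k))) / pi)"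
  have D: "\<Delta> holomorphic_on UNIV" "conj_fun \<Delta> = \<Delta>"
     "((\<lambda>y::real. F_fun \<alpha> \<beta> \<Delta> (\<i> * of_real y)) \<longlongrightarrow> 1) at_top"
    using J unfolding class_J_def by blast+
  obtain L where L: "((\<lambda>y::real. y * norm (F_fun \<alpha> \<beta> \<Delta> (\<i> * of_real y) - 1)) \<longlongrightarrow> L) at_top"
    using J unfolding class_J_def by blast
  obtain M where M: "\<And>z. norm (\<Delta> z) \<le> M * exp (pi * \<bar>Im z\<bar>)"
    using class_J_exponential_bound[OF J] by blast
  obtain \<sigma> where \<sigma>: "\<bar>\<sigma>\<bar> = 1" "\<And>k. \<sigma> * r k \<ge> 0"
    using class_J_residues_one_signed[OF J] unfolding r_def l_def by blast
  define D' where "D' = (\<lambda>z. \<Delta> (z + of_real \<gamma>))"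
  have hD': "D' holomorphic_on UNIV"
  proof -
    have "\<Delta> \<circ> (\<lambda>z. z + of_real \<gamma>) holomorphic_on UNIV"
      by (intro holomorphic_on_compose holomorphic_intros holomorphic_on_subset[OF D(1)]) auto
    thus ?thesis by (simp add: D'_def o_def)
  qed
  have bD': "norm (D' z) \<le> M * exp (pi * \<bar>Im z\<bar>)" for z using M[of "z + of_real \<gamma>"] by (simp add: D'_def)
  have shift: "z - of_real \<gamma> \<notin> \<int>" if "z \<notin> range (\<lambda>k. of_real (l k))" for z :: complex
    using that unfolding l by (auto simp: algebra_simps elim!: Ints_cases)
  have rD: "of_real (cos (pi * of_int k)) * D' (of_int k) / of_real pi = of_real (r k)" for k
  proof -
    have "D' (of_int k) = \<Delta> (of_real (l k))" by (simp only: D'_def l)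
    also have "\<dots> = of_real (Re (\<Delta> (of_real (l k))))"
      using conj_fun_eq_imp_real[OF D(2), of "l k"] by (auto elim: Reals_cases)
    finally show ?thesis by (simp only: r_def of_real_mult of_real_divide)
  qed
  have FD: "D' (z - of_real \<gamma>) / sin (of_real pi * (z - of_real \<gamma>)) = F_fun \<alpha> \<beta> \<Delta> z" for z
    unfolding F_fun_def sin_shift_lambda0 D'_def \<gamma>_def by simp
  have diff: "(\<lambda>N. \<Sum>k\<in>{-int N..int N}. of_real (r k) * (1 / (z - of_real (l k)) - 1 / (w - of_real (l k))))
       \<longlonglongrightarrow> F_fun \<alpha> \<beta> \<Delta> z - F_fun \<alpha> \<beta> \<Delta> w"
    if "z \<notin> range (\<lambda>k. of_real (l k))" "w \<notin> range (\<lambda>k. of_real (l k))" for z w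
    using sin_quotient_partial_fractions[OF hD' bD' shift[OF that(1)] shift[OF that(2)]]
    unfolding rD FD l by (simp add: algebra_simps)
  \<comment> \<open>The midpoint between two poles serves as the real reference point, at which the
    quotient is real and defined.\<close>
  have w0: "\<gamma> + 1/2 \<notin> range l"
  proof
    assume "\<gamma> + 1/2 \<in> range l"
    then obtain k where "\<gamma> + 1/2 = l k" by auto
    hence "1/2 = (of_int k :: real)" by (simp add: l_def lambda0_def \<gamma>_def)
    hence "of_int (2 * k) = (of_int 1 :: real)" by simp
    hence "2 * k = 1" by (simp only: of_int_eq_iff)
    thus False by presburger
  qed
  have Fw0: "Im (F_fun \<alpha> \<beta> \<Delta> (of_real (\<gamma> + 1/2))) = 0"
  proof -
    have "sin (of_real x * of_real pi - of_real \<alpha> + of_real \<beta>) = complex_of_real (sin (x * pi - \<alpha> + \<beta>))" for x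
      by (simp flip: sin_of_real)
    hence "F_fun \<alpha> \<beta> \<Delta> (of_real (\<gamma> + 1/2)) \<in> \<real>"
      unfolding F_fun_def using conj_fun_eq_imp_real[OF D(2), of "\<gamma> + 1/2"] by (metis Reals_divide Reals_of_real)
    thus ?thesis by (simp add: complex_is_Real_iff)
  qed
  have bd: "eventually (\<lambda>y::real. y * norm (F_fun \<alpha> \<beta> \<Delta> (\<i> * of_real y) - 1) \<le> L + 1) at_top"
    using order_tendstoD(2)[OF L, of "L + 1"] by (auto elim: eventually_mono)
  note pf = partial_fractions_one_signed_residues[OF diff w0 Fw0 \<sigma> D(3) bd]
  show ?thesis using that[OF \<sigma> pf(1)] pf(2) unfolding l_def by blast
qed

section \<open>Square integrability of the limit vector and solution of the inverse problem\<close>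

lemma borel_measurable_real_vec:
  assumes "u \<in> borel_measurable M"
  shows "real_vec u \<in> borel_measurable M"
proof -
  have "(vector [a, b] :: complex ^ 2) = (\<chi> i. if i = 1 then a else b)" for a b
    by (simp add: vec_eq_iff forall_2)
  moreover have "continuous_on UNIV (\<lambda>c. \<chi> i::2. if i = 1 then complex_of_real (Re c) else of_real (Im c))"
  proof (rule continuous_on_vec_lambda)
    show "continuous_on UNIV (\<lambda>c. if i = 1 then complex_of_real (Re c) else of_real (Im c))" for i :: 2
      by (cases "i = 1") (auto intro!: continuous_intros)
  qed
  ultimately have "continuous_on UNIV (\<lambda>c. vector [of_real (Re c), of_real (Im c)] :: complex ^ 2)"
    by (simp only:)
  hence "(\<lambda>x. vector [of_real (Re (u x)), of_real (Im (u x))] :: complex ^ 2) \<in> borel_measurable M"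
    by (rule borel_measurable_continuous_on[OF _ assms])
  thus ?thesis by (simp add: real_vec_def[abs_def])
qed

lemma real_vec_mem_L2_0_pi:
  assumes [measurable]: "u \<in> borel_measurable lborel" "D \<in> borel_measurable lborel"
    and D: "integrable lborel (\<lambda>x. (D x)\<^sup>2)"
    and bd: "AE x in lborel. x \<in> {0..pi} \<longrightarrow> norm (u x) \<le> D x"
  shows "real_vec u \<in> L2_0_pi"
proof -
  have [measurable]: "real_vec u \<in> borel_measurable lborel" by (intro borel_measurable_real_vec assms)
  have "set_borel_measurable lborel {0..pi} (real_vec u)"
    unfolding set_borel_measurable_def by measurable
  moreover have "set_integrable lborel {0..pi} (\<lambda>x. (norm (real_vec u x))\<^sup>2)"
    unfolding set_integrable_def norm_real_vec
  proof (rule Bochner_Integration.integrable_bound[OF D])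
    show "AE x in lborel. norm (indicat_real {0..pi} x *\<^sub>R (norm (u x))\<^sup>2) \<le> norm ((D x)\<^sup>2)"
      using bd
    proof eventually_elim
      case (elim x)
      thus ?case using power_mono[of "norm (u x)" "D x" 2] by (cases "x \<in> {0..pi}") auto
    qed
  qed measurable
  ultimately show ?thesis by (simp add: L2_0_pi_def)
qed

lemma set_integrable_if_square_integrable:
  fixes D :: "real \<Rightarrow> real"
  assumes [measurable]: "D \<in> borel_measurable lborel" and D: "integrable lborel (\<lambda>x. (D x)\<^sup>2)"
  shows "set_integrable lborel {a..b} D"
  unfolding set_integrable_def
proof (rule Bochner_Integration.integrable_bound)
  show "integrable lborel (\<lambda>x. indicator {a..b} x + (D x)\<^sup>2)"
    using D by (intro Bochner_Integration.integrable_add integrable_real_indicator emeasure_bounded_finite) auto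
  have "\<bar>t\<bar> \<le> 1 + t\<^sup>2" for t :: real
    using zero_le_power2[of "\<bar>t\<bar> - 1"] by (simp add: power2_eq_square algebra_simps)
  thus "AE x in lborel. norm (indicat_real {a..b} x *\<^sub>R D x) \<le> norm (indicat_real {a..b} x + (D x)\<^sup>2)"
    by (auto simp: indicator_def)
qed measurable

theorem theorem4p3:
  fixes \<alpha> \<beta> :: real and \<Delta> :: "complex \<Rightarrow> complex"
  assumes "\<Delta> \<in> class_J \<alpha> \<beta>"
  shows "\<exists>(\<mu>::real) v. v \<in> L2_0_pi \<and> (\<forall>z. char_fun \<alpha> \<beta> \<mu> v z = \<Delta> z)"
proof -
  define \<gamma> where "\<gamma> = (\<alpha> - \<beta>) / pi"
  have hol: "\<Delta> holomorphic_on UNIV" using assms unfolding class_J_def by blast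
  obtain \<sigma> r where \<sigma>: "\<bar>\<sigma>\<bar> = (1::real)" "\<And>k. \<sigma> * r k \<ge> 0" and r: "r summable_on UNIV"
    and pf: "\<And>z. Im z \<noteq> 0 \<Longrightarrow>
      (\<lambda>N. 1 + (\<Sum>k\<in>{-int N..int N}. of_real (r k) / (z - of_real (lambda0 \<alpha> \<beta> k)))) \<longlonglongrightarrow> F_fun \<alpha> \<beta> \<Delta> z"
    using class_J_partial_fractions[OF assms] by blast
  define a where "a = (\<lambda>k. sqrt (\<sigma> * r k / pi))"
  have a2: "(a k)\<^sup>2 = \<sigma> / pi * r k" for k using \<sigma>(2)[of k] by (simp add: a_def)
  have "(\<lambda>k. (a k)\<^sup>2) summable_on UNIV" unfolding a2 by (intro summable_on_cmult_right r)
  then obtain \<rho> h D where \<rho>: "filterlim \<rho> at_top sequentially"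
    and h: "h \<in> borel_measurable lborel" and D: "D \<in> borel_measurable lborel" "integrable lborel (\<lambda>x. (D x)\<^sup>2)"
    and AE: "AE x in lborel. x \<in> {0..pi} \<longrightarrow>
        (\<forall>j. norm (trig_poly {-int (\<rho> j)..int (\<rho> j)} a \<gamma> \<alpha> x) \<le> D x) \<and>
        (\<lambda>j. trig_poly {-int (\<rho> j)..int (\<rho> j)} a \<gamma> \<alpha> x) \<longlonglongrightarrow> h x"
    by (rule trigonometric_series_L2_limit)
  have D1: "set_integrable lborel {0..pi} D" by (rule set_integrable_if_square_integrable[OF D])
  have tm: "trig_poly A a \<gamma> \<alpha> \<in> borel_measurable lborel" for A
    unfolding trig_poly_def[abs_def] measurable_lborel2
    by (intro borel_measurable_continuous_onI continuous_intros)
  have h_bd: "AE x in lborel. x \<in> {0..pi} \<longrightarrow> norm (h x) \<le> D x"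
    using AE
  proof eventually_elim
    case (elim x)
    show ?case
    proof
      assume "x \<in> {0..pi}"
      thus "norm (h x) \<le> D x"
        using elim Lim_norm_ubound[OF sequentially_bot, of "\<lambda>j. trig_poly {-int (\<rho> j)..int (\<rho> j)} a \<gamma> \<alpha> x" "h x" "D x"]
        by simp
    qed
  qed
  \<comment> \<open>The characteristic function carries 1 minus a sum, the expansion of F carries 1
    plus a sum; hence the minus sign. As \<sigma> squares to 1, \<mu> pi a_k^2 becomes -r_k.\<close>
  define \<mu> where "\<mu> = - \<sigma>"
  have ss: "\<sigma> * \<sigma> = 1" using \<sigma>(1) by (auto simp: abs_if split: if_splits)
  have nonreal: "char_fun \<alpha> \<beta> \<mu> (real_vec h) z = \<Delta> z" if z: "Im z \<noteq> 0" for z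
  proof -
    define s where "s = sin (z * of_real pi - of_real \<alpha> + of_real \<beta>)"
    have "z \<notin> range (\<lambda>k. of_real (lambda0 \<alpha> \<beta> k))" using z by auto
    hence s0: "s \<noteq> 0" unfolding s_def sin_shift_eq_0_iff .
    have \<mu>a: "\<mu> * pi * (a k)\<^sup>2 = - r k" for k
      unfolding a2 \<mu>_def using ss by simp
    have "char_fun \<alpha> \<beta> \<mu> (real_vec (trig_poly {-int N..int N} a \<gamma> \<alpha>)) z =
        s * (1 + (\<Sum>k\<in>{-int N..int N}. of_real (r k) / (z - of_real (lambda0 \<alpha> \<beta> k))))" for N
      unfolding \<gamma>_def char_fun_trig_poly[OF finite_atLeastAtMost_int z] \<mu>a s_def by (simp add: sum_negf)
    moreover have "(\<lambda>N. s * (1 + (\<Sum>k\<in>{-int N..int N}. of_real (r k) / (z - of_real (lambda0 \<alpha> \<beta> k))))) \<longlonglongrightarrow> s * F_fun \<alpha> \<beta> \<Delta> z"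
      by (intro tendsto_mult tendsto_const pf z)
    ultimately have "(\<lambda>N. char_fun \<alpha> \<beta> \<mu> (real_vec (trig_poly {-int N..int N} a \<gamma> \<alpha>)) z) \<longlonglongrightarrow> s * F_fun \<alpha> \<beta> \<Delta> z"
      by simp
    hence "(\<lambda>j. char_fun \<alpha> \<beta> \<mu> (real_vec (trig_poly {-int (\<rho> j)..int (\<rho> j)} a \<gamma> \<alpha>)) z) \<longlonglongrightarrow> s * F_fun \<alpha> \<beta> \<Delta> z"
      by (rule filterlim_compose[OF _ \<rho>])
    moreover have "(\<lambda>j. char_fun \<alpha> \<beta> \<mu> (real_vec (trig_poly {-int (\<rho> j)..int (\<rho> j)} a \<gamma> \<alpha>)) z) \<longlonglongrightarrow> char_fun \<alpha> \<beta> \<mu> (real_vec h) z"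
      by (rule tendsto_char_fun[OF tm h D1 AE tendsto_const])
    ultimately have "char_fun \<alpha> \<beta> \<mu> (real_vec h) z = s * F_fun \<alpha> \<beta> \<Delta> z" using LIMSEQ_unique by blast
    thus ?thesis using s0 by (simp add: F_fun_def s_def)
  qed
  have "char_fun \<alpha> \<beta> \<mu> (real_vec h) z = \<Delta> z" for z
  proof (cases "Im z = 0")
    case True
    \<comment> \<open>A real point is approached from the upper half-plane, where the identity is
      known; \<open>Suc n\<close> keeps the divisor positive. The limit lemma, applied to the
      constant sequence \<open>h\<close>, supplies continuity of the characteristic
      function.\<close>
    define \<zeta> where "\<zeta> = (\<lambda>n. z + \<i> * of_real (1 / real (Suc n)))"
    have "(\<lambda>n. z + \<i> * of_real (1 / real (Suc n))) \<longlonglongrightarrow> z + \<i> * of_real 0"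
      by (intro tendsto_intros LIMSEQ_Suc lim_1_over_n)
    hence \<zeta>: "\<zeta> \<longlonglongrightarrow> z" by (simp add: \<zeta>_def)
    have "(\<lambda>n. char_fun \<alpha> \<beta> \<mu> (real_vec h) (\<zeta> n)) \<longlonglongrightarrow> char_fun \<alpha> \<beta> \<mu> (real_vec h) z"
      using h_bd by (intro tendsto_char_fun[OF h h D1 _ \<zeta>]) auto
    moreover have "(\<lambda>n. \<Delta> (\<zeta> n)) \<longlonglongrightarrow> \<Delta> z"
      using continuous_on_tendsto_compose[OF holomorphic_on_imp_continuous_on[OF hol] \<zeta>] by simp
    moreover have "char_fun \<alpha> \<beta> \<mu> (real_vec h) (\<zeta> n) = \<Delta> (\<zeta> n)" for n
      using True by (intro nonreal) (simp add: \<zeta>_def)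
    ultimately show ?thesis using LIMSEQ_unique by simp
  qed (rule nonreal)
  moreover have "real_vec h \<in> L2_0_pi" by (rule real_vec_mem_L2_0_pi[OF h D h_bd])
  ultimately show ?thesis by blast
qed

end
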